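(* Every triangulation $G$ of the projective plane has a weak or near-weak $2$-coloring.
   Context: A triangulation of a surface is a graph without loops or multiple edges, 2-cell embedded on the surface such that every face is bounded by a closed walk of length 3. A 2-coloring of $G$ is a (not necessarily proper) map $c:V(G)\to\{B,W\}$. A face is monochromatic under $c$ if all its vertices receive the same color. The coloring $c$ is weak if no face is monochromatic, and near-weak if exactly one face is monochromatic. *)

theory Defs
  imports Main
begin

(* A triangulation is given combinatorially by a finite set F of face labels
   together with the vertex set  tri f  of each face (a 3-element set).
   Face labels (rather than vertex triples) are used so that distinct faces
   with the same vertex set are not identified. *)

definition tri_vertices :: "'f set \<Rightarrow> ('f \<Rightarrow> 'v set) \<Rightarrow> 'v set" where
  "tri_vertices F tri = \<Union> (tri ` F)"

definition tri_edges :: "'f set \<Rightarrow> ('f \<Rightarrow> 'v set) \<Rightarrow> 'v set set" where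
  "tri_edges F tri = {e. card e = 2 \<and> (\<exists>f\<in>F. e \<subseteq> tri f)}"

(* two distinct faces sharing an edge *)
definition face_adj :: "'f set \<Rightarrow> ('f \<Rightarrow> 'v set) \<Rightarrow> ('f \<times> 'f) set" where
  "face_adj F tri = {(f, g). f \<in> F \<and> g \<in> F \<and> f \<noteq> g \<and>
      (\<exists>e \<in> tri_edges F tri. e \<subseteq> tri f \<and> e \<subseteq> tri g)}"

(* two distinct faces at vertex v sharing an edge through v *)
definition link_adj :: "'f set \<Rightarrow> ('f \<Rightarrow> 'v set) \<Rightarrow> 'v \<Rightarrow> ('f \<times> 'f) set" where
  "link_adj F tri v = {(f, g). f \<in> F \<and> g \<in> F \<and> f \<noteq> g \<and>
      (\<exists>e \<in> tri_edges F tri. v \<in> e \<and> e \<subseteq> tri f \<and> e \<subseteq> tri g)}"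

(* A triangulated closed connected surface: every face is a triangle,
   every edge lies on exactly two faces, the faces around each vertex form a
   single cycle (link connected), and the surface is connected.  *)
definition closed_surface_triangulation :: "'f set \<Rightarrow> ('f \<Rightarrow> 'v set) \<Rightarrow> bool" where
  "closed_surface_triangulation F tri \<longleftrightarrow>
     finite F \<and> F \<noteq> {} \<and>
     (\<forall>f\<in>F. card (tri f) = 3) \<and>
     (\<forall>e\<in>tri_edges F tri. card {f\<in>F. e \<subseteq> tri f} = 2) \<and>
     (\<forall>v\<in>tri_vertices F tri. \<forall>f\<in>F. \<forall>g\<in>F.
         v \<in> tri f \<longrightarrow> v \<in> tri g \<longrightarrow> (f, g) \<in> (link_adj F tri v)\<^sup>*) \<and>
     (\<forall>f\<in>F. \<forall>g\<in>F. (f, g) \<in> (face_adj F tri)\<^sup>*)"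

(* The projective plane is the unique closed connected surface of Euler
   characteristic 1. *)
definition projective_plane_triangulation :: "'f set \<Rightarrow> ('f \<Rightarrow> 'v set) \<Rightarrow> bool" where
  "projective_plane_triangulation F tri \<longleftrightarrow>
     closed_surface_triangulation F tri \<and>
     int (card (tri_vertices F tri)) - int (card (tri_edges F tri)) + int (card F) = 1"

(* 2-colorings: True = B, False = W *)
definition monochromatic :: "('v \<Rightarrow> bool) \<Rightarrow> 'v set \<Rightarrow> bool" where
  "monochromatic c T \<longleftrightarrow> (\<exists>b. \<forall>x\<in>T. c x = b)"

definition weak_coloring :: "'f set \<Rightarrow> ('f \<Rightarrow> 'v set) \<Rightarrow> ('v \<Rightarrow> bool) \<Rightarrow> bool" where
  "weak_coloring F tri c \<longleftrightarrow> (\<forall>f\<in>F. \<not> monochromatic c (tri f))"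

definition near_weak_coloring :: "'f set \<Rightarrow> ('f \<Rightarrow> 'v set) \<Rightarrow> ('v \<Rightarrow> bool) \<Rightarrow> bool" where
  "near_weak_coloring F tri c \<longleftrightarrow> card {f\<in>F. monochromatic c (tri f)} = 1"

end

theory Submission
  imports Defs "HOL-Library.Z2"
begin

text \<open>Let \<open>\<Gamma>\<close> be the cubic dual graph. The edges that a 2-coloring makes bichromatic form a cut of the
  triangulation, that is, an even edge set of \<open>\<Gamma>\<close>, and a face is monochromatic iff it has
  degree 0 in this set. Since the Euler characteristic is 1, the cuts have index at most two among
  the even edge sets. Take a perfect matching \<open>M\<close> of \<open>\<Gamma>\<close> (Petersen) and let \<open>H\<close> be its
  complement. If \<open>H\<close> is a cut, the coloring is weak. Otherwise it suffices to find an
  \<open>M\<close>-alternating cycle, or an odd cycle that is \<open>M\<close>-alternating except at one vertex (a blossom),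
  which is not a cut: its sum with \<open>H\<close> is a cut of degree 2 everywhere except possibly at the base
  of the blossom. Such a cycle exists because in a bridgeless cubic graph alternating cycles and
  blossoms generate the cycle space. To see this, take a Gallai-Edmonds type decomposition. Counting
  edges shows that contracting its factor-critical parts leaves a cubic bipartite graph. Its
  alternating cycles are the cycles of a strongly connected digraph, and inside the parts
  one argues by odd ears.\<close>

section \<open>Barriers and factor-critical parts\<close>

text \<open>That alternating cycles and blossoms generate the cycle space is proved in dual form. A
  labelling \<open>h\<close> of the edges over the two-element field that vanishes on all of them is
  shown to be the difference of a potential on the vertices, so it vanishes on every even set. A
  functional that vanishes on the cuts but not on \<open>H\<close> therefore cannot vanish on all of
  them, and this yields the required cycle or blossom. The gain of the dual form is that a potential
  can be extended step by step, without ever decomposing an even set. The obstacle is that two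
  alternating paths may meet in either direction: one closes an alternating cycle, the other a
  blossom. Admitting both makes either outcome usable; the price is the base of the blossom, the
  only face that may become monochromatic. The matching comes from the decomposition itself, so that
  each vertex of the separating set is matched into a part of its own. Bridgelessness is used in the
  form that an odd set of faces has at least three boundary edges; with degree 3 this makes the edge
  count tight.\<close>

theorem hall_marriage:
  fixes N :: "'a \<Rightarrow> 'b set"
  assumes "finite S" "\<And>s. s \<in> S \<Longrightarrow> finite (N s)"
    and "\<And>X. X \<subseteq> S \<Longrightarrow> card X \<le> card (\<Union>(N ` X))"
  shows "\<exists>f. inj_on f S \<and> (\<forall>s\<in>S. f s \<in> N s)"
  using assms
proof (induction "card S" arbitrary: S N rule: less_induct)
  case less
  note hall = less.prems(3)
  have fin: "finite (\<Union>(N ` X))" if "X \<subseteq> S" for X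
    using that less.prems(1,2) by (meson finite_UN_I finite_subset subsetD)
  consider "S = {}" 
    | (strict) "S \<noteq> {}" "\<forall>X. X \<subset> S \<longrightarrow> X \<noteq> {} \<longrightarrow> card X < card (\<Union>(N ` X))"
    | (tight) X where "X \<subset> S" "X \<noteq> {}" "card X = card (\<Union>(N ` X))"
    using hall by (metis le_neq_implies_less psubset_imp_subset)
  then show ?case
  proof cases
    case 1
    then show ?thesis by simp
  next
    case strict
    \<comment> \<open>With slack at every proper subset, any neighbour \<open>y\<close> of
      \<open>s\<close> can be spent: each neighbourhood loses at most one element.\<close>
    then obtain s where s: "s \<in> S" by blast
    have "card {s} \<le> card (\<Union>(N ` {s}))" using hall s by blast
    then obtain y where y: "y \<in> N s" by fastforce
    have "\<exists>f. inj_on f (S - {s}) \<and> (\<forall>x\<in>S - {s}. f x \<in> N x - {y})"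
    proof (rule less.hyps)
      show "card (S - {s}) < card S" using s less.prems(1) by (meson card_Diff1_less)
      show "card X \<le> card (\<Union>x\<in>X. N x - {y})" if X: "X \<subseteq> S - {s}" for X
      proof (cases "X = {}")
        case False
        have "X \<subset> S" using X s by blast
        then have "card X < card (\<Union>(N ` X))" using strict False by blast
        moreover have "card (\<Union>(N ` X)) - 1 \<le> card (\<Union>(N ` X) - {y})"
          by (simp add: card_Diff_singleton_if)
        ultimately have "card X \<le> card (\<Union>(N ` X) - {y})" by linarith
        also have "\<Union>(N ` X) - {y} = (\<Union>x\<in>X. N x - {y})" by blast
        finally show ?thesis .
      qed simp
    qed (use less.prems in auto)
    then obtain f where f: "inj_on f (S - {s})" "\<forall>x\<in>S - {s}. f x \<in> N x - {y}" by blast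
    have "inj_on (f(s := y)) (insert s (S - {s}))"
      using f by (subst inj_on_insert) (auto simp: inj_on_def)
    then have "inj_on (f(s := y)) S" using s by (simp add: insert_absorb)
    then show ?thesis using f(2) y by (intro exI[of _ "f(s := y)"]) auto
  next
    case tight
    have XS: "X \<subseteq> S" using tight by blast
    have finX: "finite X" using XS less.prems(1) finite_subset by blast
    have "\<exists>f. inj_on f X \<and> (\<forall>x\<in>X. f x \<in> N x)"
    proof (rule less.hyps)
      show "card X < card S" by (rule psubset_card_mono[OF less.prems(1) tight(1)])
    qed (use XS finX less.prems in auto)
    then obtain f where f: "inj_on f X" "\<forall>x\<in>X. f x \<in> N x" by blast
    \<comment> \<open>The tight set \<open>X\<close> uses up all of \<open>?T\<close>. Hall's
      condition for \<open>X \<union> Y\<close> minus the equality for \<open>X\<close> is Hall's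
      condition for \<open>Y\<close> outside \<open>?T\<close>.\<close>
    let ?T = "\<Union>(N ` X)"
    have "\<exists>g. inj_on g (S - X) \<and> (\<forall>x\<in>S - X. g x \<in> N x - ?T)"
    proof (rule less.hyps)
      show "card (S - X) < card S" using tight less.prems(1) by (intro psubset_card_mono) auto
      show "card Y \<le> card (\<Union>x\<in>Y. N x - ?T)" if Y: "Y \<subseteq> S - X" for Y
      proof -
        have finY: "finite Y" using Y less.prems(1) finite_subset by blast
        have "card X + card Y = card (X \<union> Y)"
          using Y finX finY by (subst card_Un_disjoint) auto
        also have "\<dots> \<le> card (\<Union>(N ` (X \<union> Y)))" using Y XS by (intro hall) auto
        also have "\<Union>(N ` (X \<union> Y)) = ?T \<union> (\<Union>x\<in>Y. N x - ?T)" by blast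
        also have "card \<dots> \<le> card ?T + card (\<Union>x\<in>Y. N x - ?T)" by (rule card_Un_le)
        finally show ?thesis using tight by simp
      qed
    qed (use less.prems in auto)
    then obtain g where g: "inj_on g (S - X)" "\<forall>x\<in>S - X. g x \<in> N x - ?T" by blast
    let ?h = "\<lambda>x. if x \<in> X then f x else g x"
    have "inj_on ?h (X \<union> (S - X))"
    proof (rule inj_on_disjoint_Un)
      have "f ` X \<subseteq> ?T" using f(2) by blast
      moreover have "g ` (S - X) \<inter> ?T = {}" using g(2) by blast
      ultimately show "f ` X \<inter> g ` (S - X) = {}" by blast
    qed (rule f(1), rule g(1))
    moreover have "X \<union> (S - X) = S" using XS by blast
    ultimately have "inj_on ?h S" by simp
    moreover have "\<forall>s\<in>S. ?h s \<in> N s" using f(2) g(2) by simp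
    ultimately show ?thesis by (intro exI[of _ ?h] conjI)
  qed
qed

definition perfect_matching :: "'a set set \<Rightarrow> 'a set \<Rightarrow> ('a \<Rightarrow> 'a) \<Rightarrow> bool" where
  "perfect_matching E U m \<longleftrightarrow> (\<forall>x\<in>U. m x \<in> U \<and> m (m x) = x \<and> {x, m x} \<in> E)"

definition factor_critical :: "'a set set \<Rightarrow> 'a set \<Rightarrow> bool" where
  "factor_critical E C \<longleftrightarrow> (\<forall>c\<in>C. \<exists>m. perfect_matching E (C - {c}) m)"

definition nonadjacent :: "'a set set \<Rightarrow> 'a set \<Rightarrow> 'a set \<Rightarrow> bool" where
  "nonadjacent E A B \<longleftrightarrow> A \<inter> B = {} \<and> (\<forall>a\<in>A. \<forall>b\<in>B. {a, b} \<notin> E)"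

text \<open>Parts need only be odd, and a remainder outside \<open>S\<close> and \<open>P\<close> is
  allowed. This leaves the extremal argument room to move vertices between \<open>S\<close>, the
  parts and the remainder.\<close>

definition barrier :: "'a set set \<Rightarrow> 'a set \<Rightarrow> 'a set \<Rightarrow> 'a set set \<Rightarrow> bool" where
  "barrier E V S P \<longleftrightarrow> S \<subseteq> V \<and> \<Union>P \<subseteq> V - S \<and> pairwise (nonadjacent E) P \<and>
     (\<forall>C\<in>P. odd (card C) \<and> nonadjacent E C (V - S - \<Union>P))"

text \<open>A Gallai-Edmonds structure with empty remainder; \<open>\<sigma>\<close> is the
  injection that Hall's theorem provides.\<close>

definition matched_barrier :: "'a set set \<Rightarrow> 'a set \<Rightarrow> 'a set \<Rightarrow> 'a set set \<Rightarrow> ('a \<Rightarrow> 'a set) \<Rightarrow> bool" where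
  "matched_barrier E V S P \<sigma> \<longleftrightarrow> S \<union> \<Union>P = V \<and> S \<inter> \<Union>P = {} \<and> pairwise (nonadjacent E) P \<and>
     (\<forall>C\<in>P. odd (card C) \<and> factor_critical E C) \<and> inj_on \<sigma> S \<and> (\<forall>s\<in>S. \<sigma> s \<in> P \<and> (\<exists>x\<in>\<sigma> s. {s, x} \<in> E))"

lemma nonadjacent_sym: "nonadjacent E A B \<Longrightarrow> nonadjacent E B A"
  unfolding nonadjacent_def by (metis Int_commute insert_commute)

lemma nonadjacent_mono: "nonadjacent E A B \<Longrightarrow> A' \<subseteq> A \<Longrightarrow> B' \<subseteq> B \<Longrightarrow> nonadjacent E A' B'"
  unfolding nonadjacent_def by blast

text \<open>Match each \<open>s\<close> to a neighbour in its part and complete inside the part by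
  factor-criticality. The conclusion keeps this shape, because later each part has to be left by
  exactly one matching edge.\<close>

lemma matched_barrier_pmatch:
  assumes d: "matched_barrier E V S P \<sigma>" and surj: "\<sigma> ` S = P"
  shows "\<exists>m. perfect_matching E V m \<and> (\<forall>s\<in>S. m s \<in> \<sigma> s \<and> perfect_matching E (\<sigma> s - {m s}) m)"
proof -
  have "\<forall>s\<in>S. \<exists>t. t \<in> \<sigma> s \<and> {s, t} \<in> E" using d unfolding matched_barrier_def by blast
  then obtain t where t: "\<And>s. s \<in> S \<Longrightarrow> t s \<in> \<sigma> s \<and> {s, t s} \<in> E" by metis
  have "\<forall>s\<in>S. \<exists>n. perfect_matching E (\<sigma> s - {t s}) n"
    using d t surj unfolding matched_barrier_def factor_critical_def by blast
  then obtain n where n: "\<And>s. s \<in> S \<Longrightarrow> perfect_matching E (\<sigma> s - {t s}) (n s)" by metis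
  define idx where "idx x = (THE s. s \<in> S \<and> x \<in> \<sigma> s)" for x
  have idx: "idx x = s" if "s \<in> S" "x \<in> \<sigma> s" for x s
  proof -
    have "s' = s" if "s' \<in> S" "x \<in> \<sigma> s'" for s'
    proof (rule ccontr)
      assume "s' \<noteq> s"
      then have "\<sigma> s' \<noteq> \<sigma> s" "\<sigma> s \<in> P" "\<sigma> s' \<in> P"
        using d that \<open>s \<in> S\<close> unfolding matched_barrier_def by (auto dest: inj_onD)
      then have "nonadjacent E (\<sigma> s') (\<sigma> s)" using d unfolding matched_barrier_def pairwise_def by simp
      then show False using that \<open>x \<in> \<sigma> s\<close> unfolding nonadjacent_def by blast
    qed
    then show ?thesis unfolding idx_def using that by (intro the_equality) blast+
  qed
  define m where "m x = (if x \<in> S then t x else if x = t (idx x) then idx x else n (idx x) x)" for x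
  have disj: "x \<notin> S" if "s \<in> S" "x \<in> \<sigma> s" for x s
    using d that unfolding matched_barrier_def by blast
  have mS: "m s = t s" if "s \<in> S" for s using that by (simp add: m_def)
  have mt: "m (t s) = s" if "s \<in> S" for s
    using that t disj idx by (simp add: m_def)
  have mn: "m x = n s x" if "s \<in> S" "x \<in> \<sigma> s - {t s}" for s x
    using that disj idx by (auto simp: m_def)
  have pm: "perfect_matching E (\<sigma> s - {t s}) m" if s: "s \<in> S" for s
    using n[OF s] mn[OF s] unfolding perfect_matching_def by auto
  have "perfect_matching E V m"
    unfolding perfect_matching_def
  proof
    fix x assume x: "x \<in> V"
    have sub: "S \<subseteq> V" "\<And>s. s \<in> S \<Longrightarrow> \<sigma> s \<subseteq> V" using d surj unfolding matched_barrier_def by blast+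
    consider "x \<in> S" | s where "s \<in> S" "x = t s" | s where "s \<in> S" "x \<in> \<sigma> s - {t s}"
      using x d surj unfolding matched_barrier_def by blast
    then show "m x \<in> V \<and> m (m x) = x \<and> {x, m x} \<in> E"
    proof cases
      case 1
      then show ?thesis using mS mt t sub by fastforce
    next
      case 2
      then show ?thesis using mS mt t sub by (metis insert_commute subsetD)
    next
      case 3
      then show ?thesis using pm[OF 3(1)] sub unfolding perfect_matching_def by blast
    qed
  qed
  then show ?thesis using mS t pm by metis
qed

text \<open>In an extremal barrier, each missing property would produce a better barrier. The
  induction on \<open>card V\<close> supplies the decomposition of a part with one vertex
  removed.\<close>

theorem ex_matched_barrier:
  assumes "finite V" and E: "\<And>e. e \<in> E \<Longrightarrow> card e = 2"
  shows "\<exists>S P \<sigma>. matched_barrier E V S P \<sigma>"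
  using assms(1)
proof (induction "card V" arbitrary: V rule: less_induct)
  case less
  note finV = less.prems
  \<comment> \<open>lexicographic order on \<open>card P - card S\<close> and \<open>card S\<close>, as one natural number\<close>
  define val where "val = (\<lambda>(S :: 'a set, P :: 'a set set). (card P + card V - card S) * (card V + 1) + card S)"
  define Q where "Q = {(S, P). barrier E V S P}"
  have Qsub: "Q \<subseteq> Pow V \<times> Pow (Pow V)" unfolding Q_def barrier_def by blast
  then have finQ: "finite Q" using finV by (meson finite_Pow_iff finite_SigmaI finite_subset)
  have "({}, {}) \<in> Q" unfolding Q_def barrier_def by simp
  then have "Q \<noteq> {}" by blast
  then have "Max (val ` Q) \<in> val ` Q" using finQ by (intro Max_in) auto
  then obtain SP where SP: "SP \<in> Q" and "Max (val ` Q) = val SP" by blast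
  then have "\<And>X. X \<in> Q \<Longrightarrow> val X \<le> val SP" using finQ by (metis Max_ge finite_imageI imageI)
  with SP obtain S P where bar: "barrier E V S P"
    and mx: "\<And>S' P'. barrier E V S' P' \<Longrightarrow> val (S', P') \<le> val (S, P)"
    unfolding Q_def by (cases SP) auto
  have card_le: "card S' \<le> card V" if "barrier E V S' P'" for S' P'
    using that finV unfolding barrier_def by (simp add: card_mono)
  have finP: "finite P" "finite S" using bar finV unfolding barrier_def
    by (meson Diff_subset finite_UnionD finite_subset)+
  have max1: "card P' + card S \<le> card P + card S'" if b: "barrier E V S' P'" for S' P'
  proof (rule ccontr)
    assume "\<not> ?thesis"
    then have "card P' + card V - card S' \<ge> (card P + card V - card S) + 1"
      using card_le[OF b] card_le[OF bar] by linarith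
    then have "(card P' + card V - card S') * (card V + 1) \<ge> (card P + card V - card S) * (card V + 1) + (card V + 1)"
      by (metis add_mult_distrib mult_1 mult_le_mono1)
    then have "val (S', P') > val (S, P)" unfolding val_def using card_le[OF bar] by simp
    then show False using mx[OF b] by simp
  qed
  have max2: "card S' \<le> card S" if b: "barrier E V S' P'" and eq: "card P' + card S = card P + card S'" for S' P'
  proof -
    have "card P' + card V - card S' = card P + card V - card S"
      using card_le[OF b] card_le[OF bar] eq by linarith
    then show ?thesis using mx[OF b] unfolding val_def by simp
  qed
  let ?R = "V - S - \<Union>P"
  have dd: "pairwise (nonadjacent E) P" "\<And>C. C \<in> P \<Longrightarrow> odd (card C)" "S \<subseteq> V" "\<Union>P \<subseteq> V - S"
    "\<And>C. C \<in> P \<Longrightarrow> nonadjacent E C ?R"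
    using bar unfolding barrier_def by auto
  have ne: "{} \<notin> P" using dd(2) by fastforce
  \<comment> \<open>An odd remainder could become a part, raising the difference. From an even one,
    a vertex could go to \<open>S\<close> and the rest become a part, keeping the difference and
    enlarging \<open>S\<close>.\<close>
  have R: "?R = {}"
  proof (rule ccontr)
    assume "?R \<noteq> {}"
    then obtain v where v: "v \<in> ?R" by blast
    show False
    proof (cases "odd (card ?R)")
      case True
      have b: "barrier E V S (insert ?R P)"
        unfolding barrier_def using dd True
        by (auto simp: pairwise_insert nonadjacent_sym) (auto simp: nonadjacent_def)
      have "?R \<notin> P" using v by blast
      then show False using max1[OF b] finP by simp
    next
      case False
      let ?R' = "?R - {v}"
      have "Suc (card ?R') = card ?R" using v finV by (intro card_Suc_Diff1) auto
      then have odd: "odd (card ?R')" using False by (metis even_Suc)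
      have eq: "V - insert v S - \<Union>(insert ?R' P) = {}" by blast
      have n: "nonadjacent E C {}" for C unfolding nonadjacent_def by simp
      have b: "barrier E V (insert v S) (insert ?R' P)"
        unfolding barrier_def eq
      proof (intro conjI ballI)
        have "nonadjacent E C ?R'" if "C \<in> P" for C
          using nonadjacent_mono[OF dd(5)[OF that] order_refl Diff_subset] .
        then show "pairwise (nonadjacent E) (insert ?R' P)"
          using dd(1) by (simp add: pairwise_insert nonadjacent_sym)
      qed (use dd odd v n in auto)
      have "?R' \<noteq> {}" using odd by (metis card.empty even_zero)
      then have "?R' \<notin> P" by blast
      then have "card (insert ?R' P) + card S = card P + card (insert v S)" using finP v by simp
      then show False using max2[OF b] finP v by simp
    qed
  qed
  have V: "S \<union> \<Union>P = V" using R dd by blast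
  have fc: "factor_critical E C" if C: "C \<in> P" for C
    unfolding factor_critical_def
  proof
    fix c assume c: "c \<in> C"
    let ?D = "C - {c}"
    have CV: "C \<subseteq> V" using C V by blast
    have finC: "finite C" using CV finV finite_subset by blast
    have "card ?D < card C" using c finC by (intro psubset_card_mono) auto
    also have "card C \<le> card V" using CV finV by (rule card_mono[rotated])
    finally have "card ?D < card V" .
    then obtain S' P' \<sigma>' where d: "matched_barrier E ?D S' P' \<sigma>'" using less.hyps[of ?D] finC by blast
    have D': "S' \<union> \<Union>P' = ?D" using d unfolding matched_barrier_def by blast
    have "finite (S' \<union> \<Union>P')" using finC unfolding D' by simp
    then have finU: "finite (\<Union>P')" and finS': "finite S'" by auto
    have finP': "finite P'" "finite S'" "\<And>X. X \<in> P' \<Longrightarrow> finite X"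
      using finU finS' by (auto intro: finite_UnionD finite_subset[OF Union_upper])
    have ne': "{} \<notin> P'" using d unfolding matched_barrier_def by fastforce
    have sub: "\<sigma>' ` S' \<subseteq> P'" "inj_on \<sigma>' S'" using d unfolding matched_barrier_def by auto
    have cle: "card S' \<le> card P'" using card_inj_on_le[OF sub(2,1) finP'(1)] .
    show "\<exists>m. perfect_matching E ?D m"
    proof (cases "card S' = card P'")
      case True
      then have "\<sigma>' ` S' = P'" using sub finP' by (simp add: card_image card_subset_eq)
      then show ?thesis using matched_barrier_pmatch[OF d] by blast
    next
      case False
      have "card ?D = card S' + card (\<Union>P')" 
        using d finU finS' unfolding matched_barrier_def by (metis card_Un_disjoint)
      also have "card (\<Union>P') = (\<Sum>X\<in>P'. card X)"
      proof (rule card_Union_disjoint)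
        show "pairwise disjnt P'"
          using d unfolding matched_barrier_def pairwise_def nonadjacent_def disjnt_def by blast
      qed (rule finP'(3))
      finally have *: "card ?D = card S' + (\<Sum>X\<in>P'. card X)" .
      have "even (\<Sum>X\<in>P'. card X) = even (card P')"
      proof -
        have "{X \<in> P'. odd (card X)} = P'" using d unfolding matched_barrier_def by blast
        then show ?thesis using finP'(1) by (simp add: even_sum_iff)
      qed
      moreover have "even (card ?D)" using dd(2)[OF C] c finC by simp
      \<comment> \<open>Since \<open>card ?D\<close> is even and all parts in \<open>P'\<close> are
        odd, the excess of \<open>P'\<close> over \<open>S'\<close> is even, hence at least 2. This
        pays for losing the part \<open>C\<close> and for moving \<open>c\<close> to the separating
        set, so refining \<open>C\<close> keeps the difference and enlarges
        \<open>S\<close>.\<close>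
      ultimately have par: "even (card S' + card P')" using * by simp
      then have big: "card P' \<ge> card S' + 2" using False cle by presburger
      let ?T = "S \<union> insert c S'" and ?PP = "(P - {C}) \<union> P'"
      have S'C: "S' \<subseteq> C - {c}" "\<And>X. X \<in> P' \<Longrightarrow> X \<subseteq> C - {c}" "S' \<inter> \<Union>P' = {}" "S' \<union> \<Union>P' = C - {c}"
        using d unfolding matched_barrier_def by blast+
      have oth: "X \<inter> C = {}" "nonadjacent E X C" if "X \<in> P - {C}" for X
        using dd(1) C that unfolding pairwise_def nonadjacent_def by blast+
      have disjPP: "(P - {C}) \<inter> P' = {}"
      proof -
        have "X = {}" if "X \<in> P - {C}" "X \<in> P'" for X
          using oth(1)[OF that(1)] S'C(2)[OF that(2)] by blast
        then show ?thesis using ne' by blast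
      qed
      have SC: "S \<inter> C = {}" using dd(4) C by blast
      have b: "barrier E V ?T ?PP"
      proof -
        have un: "\<Union>?PP = V - ?T"
        proof -
          have "\<Union>(P - {C}) = V - S - C" using V dd(4) oth(1) C by blast
          moreover have "\<Union>P' = C - insert c S'" using S'C c by blast
          ultimately have "\<Union>?PP = (V - S - C) \<union> (C - insert c S')" by simp
          also have "\<dots> = V - ?T" using CV SC S'C(1) c by blast
          finally show ?thesis .
        qed
        have x: "nonadjacent E A B" "nonadjacent E B A" if "A \<in> P - {C}" "B \<in> P'" for A B
          using nonadjacent_mono[OF oth(2)[OF that(1)] order_refl, of B] S'C(2)[OF that(2)] nonadjacent_sym by blast+
        have y: "pairwise (nonadjacent E) P'" "pairwise (nonadjacent E) (P - {C})"
          using d dd(1) unfolding matched_barrier_def by (auto intro: pairwise_subset)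
        have "pairwise (nonadjacent E) ?PP"
        proof (rule pairwiseI)
          fix A B assume "A \<in> ?PP" "B \<in> ?PP" "A \<noteq> B"
          then show "nonadjacent E A B" using x y[THEN pairwiseD] by (metis UnE)
        qed
        moreover have "odd (card X)" if "X \<in> ?PP" for X using that dd(2) d unfolding matched_barrier_def by blast
        moreover have "nonadjacent E X (V - ?T - \<Union>?PP)" for X unfolding un nonadjacent_def by simp
        ultimately show ?thesis unfolding barrier_def using un dd(3) S'C(1) CV c by blast
      qed
      have "card ?PP = card P - 1 + card P'" using disjPP finP finP' C
        by (simp add: card_Un_disjoint)
      moreover have "card ?T = card S + (card S' + 1)"
      proof -
        have "S \<inter> insert c S' = {}" "c \<notin> S'" using SC S'C(1) c by blast+
        then show ?thesis using finP finP' by (simp add: card_Un_disjoint)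
      qed
      moreover have "card P \<ge> 1" using C finP by (metis One_nat_def Suc_leI card_gt_0_iff empty_iff)
      moreover note max1[OF b] max2[OF b] big
      ultimately show ?thesis by linarith
    qed
  qed
  define N where "N s = {C \<in> P. \<exists>x\<in>C. {s, x} \<in> E}" for s
  have "\<exists>f. inj_on f S \<and> (\<forall>s\<in>S. f s \<in> N s)"
  proof (rule hall_marriage)
    show "finite S" "\<And>s. finite (N s)" using finP unfolding N_def by auto
    fix X assume X: "X \<subseteq> S"
    let ?N = "\<Union>(N ` X)"
    have NP: "?N \<subseteq> P" unfolding N_def by blast
    \<comment> \<open>Dropping \<open>X\<close> together with all parts adjacent to it leaves a
      barrier, so extremality of the difference is Hall's condition for \<open>X\<close>.\<close>
    have b: "barrier E V (S - X) (P - ?N)"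
    proof -
      have "V - (S - X) - \<Union>(P - ?N) = X \<union> \<Union>?N"
      proof -
        have "A \<inter> B = {}" if "A \<in> P - ?N" "B \<in> ?N" for A B
          using pairwiseD[OF dd(1), of A B] that NP unfolding nonadjacent_def by blast
        then have "\<Union>(P - ?N) \<inter> \<Union>?N = {}" by blast
        moreover have u: "\<Union>P = \<Union>(P - ?N) \<union> \<Union>?N" using NP by blast
        moreover have "S \<inter> \<Union>P = {}" using dd(4) by blast
        moreover have "V = S \<union> (\<Union>(P - ?N) \<union> \<Union>?N)" using V u by simp
        moreover have "V - (S - X) - A = X \<union> B"
          if "V = S \<union> (A \<union> B)" "S \<inter> (A \<union> B) = {}" "A \<inter> B = {}" for A B
          using that X by blast
        ultimately show ?thesis by simp
      qed
      moreover have "nonadjacent E C (X \<union> \<Union>?N)" if "C \<in> P - ?N" for C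
      proof -
        have n: "nonadjacent E C X'" if X': "X' \<in> ?N" for X'
        proof (rule pairwiseD[OF dd(1)])
          show "C \<in> P" "C \<noteq> X'" using \<open>C \<in> P - ?N\<close> X' by auto
          show "X' \<in> P" using NP X' by (rule subsetD)
        qed
        moreover have "{x, y} \<notin> E" if "x \<in> C" "y \<in> X" for x y
        proof
          assume "{x, y} \<in> E"
          then have "C \<in> N y" using that \<open>C \<in> P - ?N\<close> unfolding N_def by (auto simp: insert_commute)
          then show False using \<open>C \<in> P - ?N\<close> that by blast
        qed
        moreover have "C \<inter> X = {}" using dd(4) X \<open>C \<in> P - ?N\<close> by blast
        moreover have "C \<inter> \<Union>?N = {}"
        proof -
          have "C \<inter> X' = {}" if "X' \<in> ?N" for X' using n[OF that] unfolding nonadjacent_def by (rule conjunct1)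
          then show ?thesis by (simp only: Int_Union) auto
        qed
        moreover have "{a, b} \<notin> E" if "a \<in> C" "b \<in> \<Union>?N" for a b
          using n that unfolding nonadjacent_def by (metis UnionE)
        ultimately show ?thesis unfolding nonadjacent_def
          by (metis Int_Un_distrib Un_iff Un_empty_right)
      qed
      moreover have "pairwise (nonadjacent E) (P - ?N)" using dd(1) by (rule pairwise_subset) blast
      moreover have "\<Union>(P - ?N) \<subseteq> V - (S - X)" using dd(4) by blast
      moreover have "S - X \<subseteq> V" using dd(3) by blast
      moreover have "\<forall>C\<in>P - ?N. odd (card C)" using dd(2) by blast
      ultimately show ?thesis unfolding barrier_def by simp
    qed
    have "card (P - ?N) = card P - card ?N" "card ?N \<le> card P"
      using NP finP by (auto simp: card_Diff_subset finite_subset card_mono)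
    moreover have "card (S - X) = card S - card X" "card X \<le> card S"
      using X finP by (auto simp: card_Diff_subset finite_subset card_mono)
    ultimately show "card X \<le> card ?N" using max1[OF b] by linarith
  qed
  then obtain \<sigma> where "inj_on \<sigma> S" "\<And>s. s \<in> S \<Longrightarrow> \<sigma> s \<in> N s" by blast
  then have "matched_barrier E V S P \<sigma>"
    unfolding matched_barrier_def N_def using V dd(1,2,4) fc by blast
  then show ?case by blast
qed

section \<open>Alternating cycles and blossoms inside a factor-critical part\<close>

declare add_bit_eq_xor [simp del]

lemma bit_add_self [simp]: "(x :: bit) + x = 0"
  by (cases x) simp_all

definition edges_at :: "'a set set \<Rightarrow> 'a \<Rightarrow> 'a set set" where
  "edges_at X v = {e \<in> X. v \<in> e}"

text \<open>The exceptional vertex \<open>w\<close> is the base of a blossom; without it, \<open>C\<close> is a union of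
  alternating cycles.\<close>

definition alt_circuit :: "'a set set \<Rightarrow> 'a set \<Rightarrow> ('a \<Rightarrow> 'a) \<Rightarrow> 'a set set \<Rightarrow> bool" where
  "alt_circuit E V m C \<longleftrightarrow> C \<subseteq> E \<and>
     (\<exists>w. \<forall>v\<in>V. edges_at C v = {} \<or> card (edges_at C v) = 2 \<and> ({v, m v} \<in> C \<or> v = w))"

lemma edges_at_insert: "edges_at (insert e X) v = (if v \<in> e then insert e (edges_at X v) else edges_at X v)"
  unfolding edges_at_def by auto

lemma edges_at_notin: "edges_at X v = {} \<Longrightarrow> v \<in> e \<Longrightarrow> e \<notin> X"
  unfolding edges_at_def by auto

lemma bit_shift: "(x :: bit) + y = z \<longleftrightarrow> x = z + y"
  by (cases x; cases y; cases z) auto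

lemma card2_insert: "card A = 1 \<Longrightarrow> x \<notin> A \<Longrightarrow> card (insert x A) = 2"
  by (metis card_1_singletonE card_2_iff' insertCI singletonD insertE card_insert_disjoint finite.emptyI finite.insertI Suc_1)

lemma perfect_matching_even:
  assumes "finite U" "perfect_matching E U n" and E: "\<And>e. e \<in> E \<Longrightarrow> card e = 2"
  shows "even (card U)"
  using assms(1,2)
proof (induction U rule: finite_psubset_induct)
  case (psubset U)
  show ?case
  proof (cases "U = {}")
    case False
    then obtain x where x: "x \<in> U" by blast
    have n: "n x \<in> U" "n (n x) = x" "{x, n x} \<in> E" using psubset.prems x unfolding perfect_matching_def by auto
    have ne: "n x \<noteq> x" using E[OF n(3)] by auto
    have "perfect_matching E (U - {x, n x}) n"
      unfolding perfect_matching_def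
    proof
      fix y assume y: "y \<in> U - {x, n x}"
      then have "n y \<in> U" "n (n y) = y" "{y, n y} \<in> E" using psubset.prems unfolding perfect_matching_def by auto
      moreover have "n y \<noteq> x" "n y \<noteq> n x" using calculation y n by auto
      ultimately show "n y \<in> U - {x, n x} \<and> n (n y) = y \<and> {y, n y} \<in> E" by simp
    qed
    then have "even (card (U - {x, n x}))" using x by (intro psubset.IH) auto
    moreover have "card U = card (U - {x, n x}) + 2"
    proof -
      have "card U = card {x, n x} + card (U - {x, n x})"
        using psubset.hyps x n by (metis card_Diff_subset card_mono empty_subsetI finite.emptyI finite.insertI insert_subset le_add_diff_inverse)
      then show ?thesis using ne by simp
    qed
    ultimately show ?thesis by simp
  qed simp
qed

text \<open>\<open>h\<close> is a gain function over the two-element field, balanced on the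
  alternating circuits by \<open>circ\<close>. The aim is a potential \<open>p\<close> with
  \<open>h {x, y} = p x + p y\<close> on all edges.\<close>

locale gain_graph =
  fixes V :: "'a set" and E :: "'a set set" and m :: "'a \<Rightarrow> 'a" and h :: "'a set \<Rightarrow> bit"
  assumes finV: "finite V"
    and E2: "\<And>e. e \<in> E \<Longrightarrow> e \<subseteq> V \<and> card e = 2"
    and match: "perfect_matching E V m"
    and circ: "\<And>C. alt_circuit E V m C \<Longrightarrow> sum h C = 0"
begin

lemma finE: "finite E"
  using E2 finV by (meson Pow_iff finite_Pow_iff finite_subset subsetI)

lemma mV: "x \<in> V \<Longrightarrow> m x \<in> V" "x \<in> V \<Longrightarrow> m (m x) = x" "x \<in> V \<Longrightarrow> {x, m x} \<in> E" "x \<in> V \<Longrightarrow> m x \<noteq> x"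
proof -
  assume x: "x \<in> V"
  show *: "m x \<in> V" "m (m x) = x" "{x, m x} \<in> E" using match x unfolding perfect_matching_def by auto
  show "m x \<noteq> x" using E2[OF *(3)] by auto
qed

lemma edgeD: assumes "{a, b} \<in> E" shows "a \<in> V" "b \<in> V" "a \<noteq> b"
  using E2[OF assms] by auto

text \<open>Alternating paths (up to disjoint alternating cycles) from \<open>a\<close> to \<open>b\<close> that start and
  end outside the matching; \<open>J\<close> is the edge set and \<open>U\<close> the set of inner vertices.\<close>

definition odd_path :: "'a \<Rightarrow> 'a \<Rightarrow> 'a set set \<Rightarrow> 'a set \<Rightarrow> bool" where
  "odd_path a b J U \<longleftrightarrow> J \<subseteq> E \<and> U \<subseteq> V \<and> a \<in> V \<and> b \<in> V \<and> a \<notin> U \<and> b \<notin> U \<and> (\<forall>x\<in>U. m x \<in> U) \<and>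
     (\<forall>v\<in>U. card (edges_at J v) = 2 \<and> {v, m v} \<in> J) \<and> (\<forall>v\<in>V - U - {a, b}. edges_at J v = {}) \<and>
     (if a = b then card (edges_at J a) = 2 else card (edges_at J a) = 1 \<and> card (edges_at J b) = 1) \<and>
     {a, m a} \<notin> J \<and> {b, m b} \<notin> J"

lemma odd_path_single:
  assumes "{a, b} \<in> E" "b \<noteq> m a"
  shows "odd_path a b {{a, b}} {}"
proof -
  have "a \<noteq> m b" using assms edgeD[OF assms(1)] mV(2) by metis
  moreover have "edges_at {{a, b}} v = (if v = a \<or> v = b then {{a, b}} else {})" for v
    unfolding edges_at_def by auto
  ultimately show ?thesis unfolding odd_path_def using assms edgeD[OF assms(1)]
    by (auto simp: doubleton_eq_iff)
qed

lemma odd_path_sym: "odd_path a b J U \<Longrightarrow> odd_path b a J U"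
  unfolding odd_path_def by (auto split: if_splits)

text \<open>The step crosses the matching edge at \<open>b\<close> and one more edge. Its target
  \<open>c\<close> may be \<open>a\<close> itself, which closes a blossom; hence the case
  \<open>a = b\<close> in \<open>odd_path\<close>.\<close>

lemma odd_path_step:
  assumes odd_path: "odd_path a b J U" and ne: "b \<noteq> a" "a \<noteq> m b" and c: "{m b, c} \<in> E" "c \<noteq> b" "c \<notin> U"
  shows "odd_path a c (insert {b, m b} (insert {m b, c} J)) (insert b (insert (m b) U))"
    and "sum h (insert {b, m b} (insert {m b, c} J)) = sum h J + h {b, m b} + h {m b, c}"
proof -
  have l: "J \<subseteq> E" "U \<subseteq> V" "a \<in> V" "b \<in> V" "a \<notin> U" "b \<notin> U" "\<And>x. x \<in> U \<Longrightarrow> m x \<in> U"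
     "\<And>v. v \<in> U \<Longrightarrow> card (edges_at J v) = 2 \<and> {v, m v} \<in> J" 
     "\<And>v. v \<in> V \<Longrightarrow> v \<notin> U \<Longrightarrow> v \<noteq> a \<Longrightarrow> v \<noteq> b \<Longrightarrow> edges_at J v = {}"
     "card (edges_at J a) = 1" "card (edges_at J b) = 1"
     "{a, m a} \<notin> J" "{b, m b} \<notin> J"
    using odd_path ne unfolding odd_path_def by auto
  note cE = edgeD[OF c(1)]
  note mb = mV[OF l(4)]
  have mbU: "m b \<notin> U" using l(7)[of "m b"] mb l(6) by auto
  have incmb: "edges_at J (m b) = {}" using l(9)[of "m b"] mb mbU ne by auto
  have nJ: "{m b, c} \<notin> J" using edges_at_notin[OF incmb] by blast
  have d: "{b, m b} \<noteq> {m b, c}" using c(2) by (auto simp: doubleton_eq_iff)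
  have finJ: "finite J" using l(1) finE finite_subset by blast
  show "sum h (insert {b, m b} (insert {m b, c} J)) = sum h J + h {b, m b} + h {m b, c}"
    using finJ nJ d l(13) by (simp add: ac_simps)
  have mc: "m c \<noteq> m b" using mV(2)[OF cE(2)] mb(2) c(2) by metis
  have ca: "card (edges_at J c) = 1" if "c = a" using that l by simp
  have cna: "edges_at J c = {}" if "c \<noteq> a" using that l(9)[of c] cE c by simp
  let ?J = "insert {b, m b} (insert {m b, c} J)"
  have i: "edges_at ?J v = edges_at J v" if "v \<noteq> b" "v \<noteq> m b" "v \<noteq> c" for v
    using that by (simp add: edges_at_insert)
  have ib: "edges_at ?J b = insert {b, m b} (edges_at J b)" using c(2) mb by (auto simp: edges_at_insert)
  have imb: "edges_at ?J (m b) = {{b, m b}, {m b, c}}" using incmb by (simp add: edges_at_insert)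
  have ic: "edges_at ?J c = insert {m b, c} (edges_at J c)" using c(2) cE by (auto simp: edges_at_insert)
  have rb: "card (edges_at ?J b) = 2 \<and> {b, m b} \<in> ?J"
    unfolding ib using l(11,13) by (auto intro: card2_insert simp: edges_at_def)
  have rmb: "card (edges_at ?J (m b)) = 2 \<and> {m b, m (m b)} \<in> ?J"
    unfolding imb using d mb by (simp add: insert_commute)
  have rU: "card (edges_at ?J v) = 2 \<and> {v, m v} \<in> ?J" if "v \<in> U" for v
    using that l(6,8) mbU c(3) i[of v] by (metis insertCI)
  have rac: "if a = c then card (edges_at ?J a) = 2 else card (edges_at ?J a) = 1 \<and> card (edges_at ?J c) = 1"
  proof (cases "a = c")
    case True
    have "card (insert {m b, c} (edges_at J c)) = 2"
      using ca True nJ by (intro card2_insert) (auto simp: edges_at_def)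
    then show ?thesis using ic True by simp
  next
    case False
    then show ?thesis using i[of a] ne l(10) ic cna by simp
  qed
  have ra: "{a, m a} \<notin> ?J"
    using l(12) ne mc by (auto simp: doubleton_eq_iff)
  have rc: "{c, m c} \<notin> ?J"
  proof -
    have "{c, m c} \<notin> J" using cna l(12) edges_at_notin[of J c "{c, m c}"] by (cases "c = a") auto
    then show ?thesis using c mc cE by (auto simp: doubleton_eq_iff)
  qed
  let ?U = "insert b (insert (m b) U)"
  have "\<forall>v\<in>?U. card (edges_at ?J v) = 2 \<and> {v, m v} \<in> ?J" using rb rmb rU by simp
  moreover have "\<forall>v\<in>V - ?U - {a, c}. edges_at ?J v = {}" using i l(9) by simp
  moreover have "\<forall>x\<in>?U. m x \<in> ?U" using l(7) mb by simp
  moreover have "?J \<subseteq> E" "?U \<subseteq> V" using l(1,2,4) c(1) mb by simp_all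
  moreover have "a \<notin> ?U" "c \<notin> ?U" using l(5) ne c cE by auto
  ultimately show "odd_path a c ?J ?U"
    unfolding odd_path_def using rac ra rc l(3) cE(2) by (intro conjI)
qed

text \<open>A closed odd path is a blossom with base \<open>a\<close>, the exceptional vertex of
  \<open>alt_circuit\<close>.\<close>

lemma odd_path_base_sum:
  assumes odd_path: "odd_path a a J U" shows "sum h J = 0"
proof (rule circ)
  have "edges_at J v = {} \<or> card (edges_at J v) = 2 \<and> ({v, m v} \<in> J \<or> v = a)" if "v \<in> V" for v
    using odd_path that unfolding odd_path_def by (cases "v \<in> U"; cases "v = a") auto
  then show "alt_circuit E V m J" using odd_path unfolding alt_circuit_def odd_path_def by auto
qed

text \<open>The matching edge at \<open>a\<close> closes the path to an alternating cycle.\<close>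

lemma odd_path_alt_sum:
  assumes odd_path: "odd_path a (m a) J U" shows "sum h J = h {a, m a}"
proof -
  have l: "J \<subseteq> E" "a \<in> V" "\<And>v. v \<in> U \<Longrightarrow> card (edges_at J v) = 2 \<and> {v, m v} \<in> J" "a \<notin> U" "m a \<notin> U"
     "\<And>v. v \<in> V \<Longrightarrow> v \<notin> U \<Longrightarrow> v \<noteq> a \<Longrightarrow> v \<noteq> m a \<Longrightarrow> edges_at J v = {}" "{a, m a} \<notin> J"
    using odd_path unfolding odd_path_def by auto
  note ma = mV[OF l(2)]
  have l1: "card (edges_at J a) = 1" "card (edges_at J (m a)) = 1" using odd_path ma unfolding odd_path_def by auto
  let ?C = "insert {a, m a} J"
  have "edges_at ?C v = {} \<or> card (edges_at ?C v) = 2 \<and> ({v, m v} \<in> ?C \<or> v = a)" if v: "v \<in> V" for v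
  proof -
    consider "v = a \<or> v = m a" | "v \<in> U" | "v \<notin> U" "v \<noteq> a" "v \<noteq> m a" by blast
    then show ?thesis
    proof cases
      case 1
      have "card (edges_at ?C v) = 2"
        using 1 l1 l(7) card2_insert[of "edges_at J v" "{a, m a}"] by (auto simp: edges_at_insert) (auto simp: edges_at_def)
      moreover have "{v, m v} = {a, m a}" using 1 ma by auto
      ultimately show ?thesis by simp
    next
      case 2
      then have "v \<noteq> a" "v \<noteq> m a" using l by auto
      then show ?thesis using l(3)[OF 2] by (simp add: edges_at_insert)
    next
      case 3
      then show ?thesis using l(6)[OF v] by (simp add: edges_at_insert)
    qed
  qed
  then have "alt_circuit E V m ?C" using l(1) ma unfolding alt_circuit_def by auto
  then have "sum h ?C = 0" by (rule circ)
  moreover have "finite J" using l(1) finE finite_subset by blast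
  ultimately have "h {a, m a} + sum h J = 0" using l(7) by simp
  then show ?thesis by (cases "sum h J"; cases "h {a, m a}") auto
qed

section \<open>Potentials and even paths to a root\<close>

definition consistent :: "('a \<Rightarrow> bit) \<Rightarrow> 'a \<Rightarrow> 'a \<Rightarrow> bool" where
  "consistent p u v \<longleftrightarrow> {u, v} \<in> E \<and> h {u, v} = p u + p v"

lemma consistent_sym: "consistent p u v \<Longrightarrow> consistent p v u"
  unfolding consistent_def by (simp add: insert_commute add.commute)

text \<open>\<open>A\<close> is the vertex set of an alternating path from the third argument to \<open>t\<close> that leaves
  through a matching edge and uses only edges on which the potential
  \<open>p\<close> computes \<open>h\<close>.\<close>

inductive even_path :: "('a \<Rightarrow> bit) \<Rightarrow> 'a \<Rightarrow> 'a \<Rightarrow> 'a set \<Rightarrow> bool" for p t where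
  base: "even_path p t t {t}"
| step: "even_path p t c A \<Longrightarrow> b \<notin> A \<Longrightarrow> m b \<notin> A \<Longrightarrow> consistent p b (m b) \<Longrightarrow> consistent p (m b) c \<Longrightarrow>
    even_path p t b (insert b (insert (m b) A))"

lemma even_path_mem: "even_path p t x A \<Longrightarrow> x \<in> A \<and> t \<in> A"
  by (induction rule: even_path.induct) auto

lemma even_path_closed: "even_path p t x A \<Longrightarrow> y \<in> A \<Longrightarrow> y \<noteq> t \<Longrightarrow> m y \<in> A"
  by (induction rule: even_path.induct) (auto simp: consistent_def dest: edgeD intro: mV)

lemma even_path_cong: "even_path p t x A \<Longrightarrow> (\<And>v. v \<in> A \<Longrightarrow> p v = p' v) \<Longrightarrow> even_path p' t x A"
proof (induction rule: even_path.induct)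
  case base
  show ?case by (rule even_path.base)
next
  case (step c A b)
  have "c \<in> A" using even_path_mem step.hyps(1) by blast
  then show ?case using step by (intro even_path.step) (auto simp: consistent_def)
qed

text \<open>Follow the even path of \<open>b\<close> until it first hits the one of \<open>a\<close>, then return along the latter.
  Together with \<open>J\<close> this closes up to an alternating cycle or to a blossom, depending on the
  direction in which the second path is joined.\<close>

lemma meet_aux:
  assumes "even_path p t a Y" "odd_path a b J U" "U \<inter> Y = {}" "b \<in> Y \<or> m b \<in> Y" "b \<noteq> m t"
  shows "sum h J = p a + p b"
  using assms
proof (induction arbitrary: J U rule: even_path.induct)
  case base
  have "b \<in> V" using base.prems(1) unfolding odd_path_def by auto
  then have "b = t" using base.prems(3,4) mV(2)[of b] by auto
  then show ?case using odd_path_base_sum base.prems(1) by simp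
next
  case (step c A a)
  have aV: "a \<in> V" "b \<in> V" using step.prems(1) unfolding odd_path_def by auto
  note ma = mV[OF aV(1)] and mb = mV[OF aV(2)]
  \<comment> \<open>The moving end \<open>a\<close> either arrives at \<open>b\<close>, closing a
    blossom, or at the partner of \<open>b\<close>, closing an alternating cycle, or advances along
    its even path.\<close>
  consider "b = a" | "b = m a" | "b \<noteq> a" "b \<noteq> m a" by blast
  then show ?case
  proof cases
    case 1
    then show ?thesis using odd_path_base_sum step.prems(1) by simp
  next
    case 2
    then show ?thesis using odd_path_alt_sum step.prems(1) step.hyps(4) by (simp add: consistent_def)
  next
    case 3
    have c: "c \<in> A" using even_path_mem step.hyps(1) by blast
    have ca: "{m a, c} \<in> E" using step.hyps(5) by (simp add: consistent_def)
    note st = odd_path_step[OF odd_path_sym[OF step.prems(1)] 3(1)[symmetric] 3(2) ca]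
    have "c \<noteq> a" "c \<notin> U" using c step.hyps step.prems by auto
    note st = st[OF this]
    have "b \<in> A \<or> m b \<in> A" using step.prems(3) 3 ma mb by auto
    then have "sum h (insert {a, m a} (insert {m a, c} J)) = p c + p b"
      using step.prems step.hyps by (intro step.IH[OF odd_path_sym[OF st(1)]]) auto
    then show ?thesis using st(2) step.hyps(4,5) unfolding consistent_def
      by (cases "p a"; cases "p b"; cases "p c"; cases "p (m a)") (auto simp: bit_shift)
  qed
qed

text \<open>Here the end \<open>b\<close> advances as long as it stays off \<open>Y\<close>; at the
  first contact \<open>meet_aux\<close> takes over and moves the end \<open>a\<close>. The root
  \<open>t\<close> lies on both even paths, so a contact must occur.\<close>

lemma meet:
  assumes "even_path p t b X" "odd_path a b J U" "U \<inter> X = {}" "even_path p t a Y" "U \<inter> Y = {}" "m t \<notin> X"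
  shows "sum h J = p a + p b"
  using assms
proof (induction arbitrary: J U rule: even_path.induct)
  case base
  then show ?case using meet_aux[OF base.prems(3,1,4)] even_path_mem by auto
next
  case (step c A b)
  show ?case
  proof (cases "b \<in> Y \<or> m b \<in> Y")
    case True
    then show ?thesis using meet_aux[OF step.prems(3,1,4)] step.prems(5) by auto
  next
    case False
    have "a \<in> Y" using even_path_mem step.prems(3) by blast
    then have 3: "b \<noteq> a" "a \<noteq> m b" using False by auto
    have c: "c \<in> A" using even_path_mem step.hyps(1) by blast
    have ca: "{m b, c} \<in> E" using step.hyps(5) by (simp add: consistent_def)
    have "c \<noteq> b" "c \<notin> U" using c step.hyps step.prems by auto
    note st = odd_path_step[OF step.prems(1) 3 ca this]
    have "sum h (insert {b, m b} (insert {m b, c} J)) = p a + p c"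
      using step.prems step.hyps False by (intro step.IH[OF st(1)]) auto
    then show ?thesis using st(2) step.hyps(4,5) unfolding consistent_def
      by (cases "p a"; cases "p b"; cases "p c"; cases "p (m b)") (auto simp: bit_shift)
  qed
qed

text \<open>Here the even path is disjoint from the odd one and can be followed to its end
  \<open>t\<close>. This is how a part is crossed.\<close>

lemma odd_path_extend:
  assumes "even_path p t b A" "odd_path a b J U" "A \<inter> insert a U = {}"
  shows "\<exists>J'. odd_path a t J' (U \<union> (A - {t})) \<and> sum h J' = sum h J + p b + p t"
  using assms
proof (induction arbitrary: J U rule: even_path.induct)
  case base
  then show ?case by (intro exI[of _ J]) (simp add: add.assoc)
next
  case (step c A b)
  have c: "c \<in> A" "t \<in> A" using even_path_mem step.hyps(1) by blast+
  have ca: "{m b, c} \<in> E" using step.hyps(5) by (simp add: consistent_def)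
  have "b \<noteq> a" "a \<noteq> m b" "c \<noteq> b" "c \<notin> U" using c step.hyps step.prems by auto
  note st = odd_path_step[OF step.prems(1) this(1,2) ca this(3,4)]
  have "A \<inter> insert a (insert b (insert (m b) U)) = {}" using step.prems step.hyps by auto
  then obtain J' where J': "odd_path a t J' (insert b (insert (m b) U) \<union> (A - {t}))"
    "sum h J' = sum h (insert {b, m b} (insert {m b, c} J)) + p c + p t"
    using step.IH[OF st(1)] by blast
  have "insert b (insert (m b) U) \<union> (A - {t}) = U \<union> (insert b (insert (m b) A) - {t})"
    using step.hyps c by auto
  moreover have "sum h J' = sum h J + p b + p t"
    using J'(2) st(2) step.hyps(4,5) unfolding consistent_def
    by (cases "p b"; cases "p c"; cases "p (m b)"; cases "p t") (auto simp: bit_shift)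
  ultimately show ?case using J'(1) by auto
qed

text \<open>A matching edge is the first edge of an even path; any other edge is an odd path of
  length one, to which \<open>meet\<close> applies. Hence only even paths need to be maintained
  while a potential is built.\<close>

lemma blob_consistent:
  assumes B: "\<And>x. x \<in> B \<Longrightarrow> \<exists>A\<subseteq>B. even_path p t x A" and t: "m t \<notin> B"
    and e: "{a, b} \<in> E" "a \<in> B" "b \<in> B"
  shows "consistent p a b"
proof (cases "b = m a")
  case True
  obtain A where A: "A \<subseteq> B" "even_path p t a A" using B e by blast
  have "a \<noteq> t" using True t e by auto
  then show ?thesis using A(2) True by (auto elim: even_path.cases)
next
  case False
  obtain X Y where X: "X \<subseteq> B" "even_path p t b X" and Y: "even_path p t a Y" using B e by meson
  have "sum h {{a, b}} = p a + p b"
    using t X(1) by (intro meet[OF X(2) odd_path_single[OF e(1) False] _ Y]) auto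
  then show ?thesis using e by (simp add: consistent_def)
qed

section \<open>Odd ears and the growth of a potential in a factor-critical part\<close>

text \<open>The list holds only the first end of each matching edge of the ear: the ear runs from
  \<open>y\<close> to \<open>x\<close>, to \<open>m x\<close>, to the next entry, and so on. Its
  closing edge from \<open>walk_end y L\<close> to \<open>z\<close> is kept apart.\<close>

fun ear_walk :: "'a \<Rightarrow> 'a list \<Rightarrow> bool" where
  "ear_walk y [] \<longleftrightarrow> True"
| "ear_walk y (x # L) \<longleftrightarrow> {y, x} \<in> E \<and> ear_walk (m x) L"

fun consistent_walk :: "('a \<Rightarrow> bit) \<Rightarrow> 'a \<Rightarrow> 'a list \<Rightarrow> bool" where
  "consistent_walk p y [] \<longleftrightarrow> True"
| "consistent_walk p y (x # L) \<longleftrightarrow> consistent p y x \<and> consistent p x (m x) \<and> consistent_walk p (m x) L"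

fun walk_end :: "'a \<Rightarrow> 'a list \<Rightarrow> 'a" where
  "walk_end y [] = y"
| "walk_end y (x # L) = walk_end (m x) L"

text \<open>This says that the matching edges of the ear are pairwise disjoint and that each is
  recorded by only one of its ends.\<close>

definition fresh :: "'a list \<Rightarrow> bool" where
  "fresh L \<longleftrightarrow> distinct L \<and> set L \<subseteq> V \<and> set L \<inter> m ` set L = {}"

abbreviation walk_verts :: "'a list \<Rightarrow> 'a set" where
  "walk_verts L \<equiv> set L \<union> m ` set L"

lemma fresh_Cons: "fresh (x # L) \<longleftrightarrow> x \<in> V \<and> x \<notin> walk_verts L \<and> m x \<notin> walk_verts L \<and> fresh L"
proof -
  have "m x \<in> m ` set L \<longleftrightarrow> x \<in> set L" if "x \<in> V" "set L \<subseteq> V"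
    using that mV(2) by (metis image_iff subset_iff)
  then show ?thesis unfolding fresh_def using mV(4) by auto
qed

lemma walk_end_append [simp]: "walk_end y (L @ [x]) = m x"
  by (induction L arbitrary: y) auto

lemma walk_end_cases: "walk_end y L = (if L = [] then y else m (last L))"
  by (induction L arbitrary: y) auto

lemma ear_walk_append: "ear_walk y (L @ [x]) \<longleftrightarrow> ear_walk y L \<and> {walk_end y L, x} \<in> E"
  by (induction L arbitrary: y) auto

lemma consistent_walk_append: "consistent_walk p y (L @ [x]) \<longleftrightarrow> consistent_walk p y L \<and> consistent p (walk_end y L) x \<and> consistent p x (m x)"
  by (induction L arbitrary: y) auto

text \<open>Even paths start with a matching edge, so the ear in its given direction serves only the
  recorded ends; its reversal serves their partners.\<close>

lemma consistent_walk_rev: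
  assumes "consistent_walk p y L" "consistent p (walk_end y L) z" "set L \<subseteq> V"
  shows "consistent_walk p z (rev (map m L)) \<and> consistent p (walk_end z (rev (map m L))) y"
  using assms
proof (induction L arbitrary: y)
  case Nil
  then show ?case by (simp add: consistent_sym)
next
  case (Cons x L)
  have pr: "consistent p y x" "consistent p x (m x)" "m (m x) = x" using Cons.prems mV(2) by simp_all
  have "consistent_walk p z (rev (map m L)) \<and> consistent p (walk_end z (rev (map m L))) (m x)"
    using Cons.prems by (intro Cons.IH) simp_all
  then show ?case using consistent_sym[OF pr(1)] consistent_sym[OF pr(2)] pr(3) by (simp add: consistent_walk_append)
qed

text \<open>The ear consists of new vertices, so the values of the potential can be set one after
  the other. Only the closing edge imposes a condition.\<close>

lemma consistent_walk_exists:
  assumes "ear_walk y L" "fresh L" "y \<notin> walk_verts L"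
  shows "\<exists>p'. (\<forall>v. v \<notin> walk_verts L \<longrightarrow> p' v = p v) \<and> consistent_walk p' y L"
  using assms
proof (induction L arbitrary: y p)
  case (Cons x L)
  have x: "x \<in> V" "x \<notin> walk_verts L" "m x \<notin> walk_verts L" "fresh L" using Cons.prems(2) by (auto simp: fresh_Cons)
  define p1 where "p1 = p(x := p y + h {y, x}, m x := p y + h {y, x} + h {x, m x})"
  obtain p' where p': "\<forall>v. v \<notin> walk_verts L \<longrightarrow> p' v = p1 v" "consistent_walk p' (m x) L"
    using Cons.IH[of "m x" p1] Cons.prems x by auto
  have "p' x = p y + h {y, x}" "p' (m x) = p y + h {y, x} + h {x, m x}" "p' y = p y"
    using p'(1) x mV(4)[OF x(1)] Cons.prems(3) unfolding p1_def by auto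
  then have "consistent p' y x" "consistent p' x (m x)" using Cons.prems mV(3)[OF x(1)] unfolding consistent_def
    by (cases "p y"; cases "h {y, x}"; cases "h {x, m x}"; auto)+
  moreover have "p' v = p v" if "v \<notin> walk_verts (x # L)" for v
    using p'(1) that unfolding p1_def by auto
  ultimately show ?case using p'(2) by auto
qed auto

text \<open>The ear with its closing edge is an odd path. The gain of the closing edge is left open,
  to be determined by comparison with \<open>meet\<close>.\<close>

lemma consistent_walk_lk:
  assumes "consistent_walk p y L" "fresh L" "{walk_end y L, z} \<in> E" "y \<in> V" "y \<notin> walk_verts L" "z \<notin> walk_verts L"
    "L = [] \<longrightarrow> z \<noteq> m y"
  shows "\<exists>J. odd_path y z J (walk_verts L) \<and> sum h J = p y + p (walk_end y L) + h {walk_end y L, z}"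
  using assms
proof (induction L arbitrary: y)
  case Nil
  then show ?case using odd_path_single[of y z] by (intro exI[of _ "{{y, z}}"]) simp
next
  case (Cons x L)
  have x: "x \<in> V" "x \<notin> walk_verts L" "m x \<notin> walk_verts L" "fresh L" using Cons.prems(2) by (auto simp: fresh_Cons)
  note mx = mV[OF x(1)]
  have zx: "z \<noteq> x" "z \<noteq> m x" "y \<noteq> x" "y \<noteq> m x" using Cons.prems by auto
  obtain J where J: "odd_path (m x) z J (walk_verts L)" "sum h J = p (m x) + p (walk_end (m x) L) + h {walk_end (m x) L, z}"
    using Cons.IH[of "m x"] Cons.prems x mx zx by auto
  have e: "{x, y} \<in> E" "{m (m x), y} \<in> E" using Cons.prems(1) mx by (auto simp: consistent_def insert_commute)
  have "m x \<noteq> z" "z \<noteq> m (m x)" "y \<noteq> m x" "y \<notin> walk_verts L" using zx mx Cons.prems by auto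
  note st = odd_path_step[OF odd_path_sym[OF J(1)] this(1,2) e(2) this(3,4)]
  let ?J = "insert {m x, m (m x)} (insert {m (m x), y} J)"
  have "odd_path y z ?J (walk_verts (x # L))"
  proof -
    have "insert (m x) (insert (m (m x)) (walk_verts L)) = walk_verts (x # L)" using mx by auto
    then show ?thesis using odd_path_sym[OF st(1)] by simp
  qed
  moreover have "sum h ?J = p y + p (walk_end y (x # L)) + h {walk_end y (x # L), z}"
  proof -
    have "h {m x, m (m x)} = p (m x) + p x" "h {m (m x), y} = p x + p y"
      using Cons.prems(1) mx by (auto simp: consistent_def insert_commute add.commute)
    then show ?thesis unfolding st(2) J(2)
      by (cases "p x"; cases "p (m x)") (auto simp: ac_simps)
  qed
  ultimately show ?case by blast
qed

text \<open>From \<open>x\<close> the even path follows the rest of the ear to \<open>z\<close> and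
  continues along the even path of \<open>z\<close>.\<close>

lemma consistent_walk_evp:
  assumes "consistent_walk p y L" "fresh L" "consistent p (walk_end y L) z" "even_path p t z A" "A \<inter> walk_verts L = {}" "x \<in> set L"
  shows "\<exists>A'\<subseteq>A \<union> walk_verts L. even_path p t x A'"
  using assms
proof (induction L arbitrary: y x)
  case (Cons u L)
  have u: "u \<in> V" "u \<notin> walk_verts L" "m u \<notin> walk_verts L" "fresh L" using Cons.prems(2) by (auto simp: fresh_Cons)
  have IH: "\<exists>A'\<subseteq>A \<union> walk_verts L. even_path p t x A'" if "x \<in> set L" for x
    using Cons.prems u that by (intro Cons.IH[of "m u" x]) auto
  show ?case
  proof (cases "x = u")
    case True
    have "\<exists>c A'. A' \<subseteq> A \<union> walk_verts L \<and> even_path p t c A' \<and> consistent p (m u) c"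
    proof (cases L)
      case Nil
      then show ?thesis using Cons.prems by (intro exI[of _ z] exI[of _ A]) auto
    next
      case (Cons w L')
      then obtain A' where "A' \<subseteq> A \<union> walk_verts L" "even_path p t w A'" using IH[of w] by auto
      moreover have "consistent p (m u) w" using Cons Cons.prems by simp
      ultimately show ?thesis by blast
    qed
    then obtain c A' where c: "A' \<subseteq> A \<union> walk_verts L" "even_path p t c A'" "consistent p (m u) c" by blast
    have "u \<notin> A'" "m u \<notin> A'" using c(1) u Cons.prems(5) by auto
    then have "even_path p t u (insert u (insert (m u) A'))"
      using c Cons.prems(1) by (intro even_path.step) auto
    moreover have "insert u (insert (m u) A') \<subseteq> A \<union> walk_verts (u # L)" using c(1) by auto
    ultimately show ?thesis unfolding True by (intro exI conjI)
  next
    case False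
    then obtain A' where A': "A' \<subseteq> A \<union> walk_verts L" "even_path p t x A'" using IH[of x] Cons.prems by auto
    have "A \<union> walk_verts L \<subseteq> A \<union> walk_verts (u # L)" by auto
    from order_trans[OF A'(1) this] A'(2) show ?thesis by (intro exI conjI)
  qed
qed simp

text \<open>Parity: \<open>m\<close> matches \<open>B - {t}\<close>, so \<open>B\<close> is odd.
  Without an edge leaving \<open>B\<close>, a matching of \<open>K\<close> that misses only some
  \<open>x\<close> outside \<open>B\<close> would restrict to \<open>B\<close> and make it
  even.\<close>

lemma ex_exit_edge:
  assumes K: "K \<subseteq> V" "t \<in> K" "perfect_matching E (K - {t}) m" "factor_critical E K"
    and B: "t \<in> B" "B \<subset> K" "\<And>x. x \<in> B \<Longrightarrow> x \<noteq> t \<Longrightarrow> m x \<in> B"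
  shows "\<exists>x\<in>K - B. \<exists>y\<in>B. {y, x} \<in> E"
proof (rule ccontr)
  assume no: "\<not> ?thesis"
  obtain x where x: "x \<in> K - B" using B by blast
  obtain n where n: "perfect_matching E (K - {x}) n" using K x unfolding factor_critical_def by blast
  have "B \<subseteq> V" using B(2) K(1) by blast
  then have finB: "finite B" using finV by (rule finite_subset)
  have "perfect_matching E B n"
    unfolding perfect_matching_def
  proof
    fix y assume y: "y \<in> B"
    then have "y \<in> K - {x}" using x B(2) by blast
    then have ny: "n y \<in> K - {x}" "n (n y) = y" "{y, n y} \<in> E" using n unfolding perfect_matching_def by simp_all
    then have "n y \<in> B" using no y by blast
    then show "n y \<in> B \<and> n (n y) = y \<and> {y, n y} \<in> E" using ny by simp
  qed
  then have 1: "even (card B)" using perfect_matching_even[OF finB] E2 by blast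
  have "perfect_matching E (B - {t}) m"
    unfolding perfect_matching_def
  proof
    fix y assume y: "y \<in> B - {t}"
    then have "y \<in> K - {t}" using B(2) by blast
    then have "m y \<in> K - {t}" "m (m y) = y" "{y, m y} \<in> E" using K(3) unfolding perfect_matching_def by simp_all
    then show "m y \<in> B - {t} \<and> m (m y) = y \<and> {y, m y} \<in> E" using B(3)[of y] y by simp
  qed
  then have "even (card (B - {t}))" using perfect_matching_even[of "B - {t}"] finB E2 by blast
  then show False using 1 B(1) finB by (metis card_Suc_Diff1 even_Suc)
qed

text \<open>Leave \<open>B\<close> by an edge to \<open>x\<close>, take a matching \<open>n\<close>
  of \<open>K\<close> that misses only \<open>x\<close>, and alternate \<open>m\<close> and
  \<open>n\<close> from \<open>x\<close>. This walk cannot repeat a vertex and so returns to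
  \<open>B\<close> by an edge of \<open>n\<close>.\<close>

lemma ex_ear:
  assumes K: "K \<subseteq> V" "t \<in> K" "perfect_matching E (K - {t}) m" "factor_critical E K"
    and B: "t \<in> B" "B \<subset> K" "\<And>x. x \<in> B \<Longrightarrow> x \<noteq> t \<Longrightarrow> m x \<in> B"
  shows "\<exists>y\<in>B. \<exists>z\<in>B. \<exists>L. L \<noteq> [] \<and> ear_walk y L \<and> fresh L \<and> set L \<subseteq> K - B \<and> {walk_end y L, z} \<in> E"
proof -
  obtain x y where x: "x \<in> K - B" and y: "y \<in> B" and xy: "{y, x} \<in> E"
    using ex_exit_edge[OF assms] by blast
  obtain n where "perfect_matching E (K - {x}) n" using K(4) x unfolding factor_critical_def by blast
  then have n: "\<And>v. v \<in> K \<Longrightarrow> v \<noteq> x \<Longrightarrow> n v \<in> K \<and> n v \<noteq> x \<and> n (n v) = v \<and> {v, n v} \<in> E"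
    unfolding perfect_matching_def by simp
  have mK: "m v \<in> K - B" if "v \<in> K - B" for v
  proof -
    have "v \<in> K - {t}" using that B(1) by auto
    then have "m v \<in> K - {t}" "m (m v) = v" using K(3) unfolding perfect_matching_def by simp_all
    then show ?thesis using B(3)[of "m v"] that by auto
  qed
  define good where "good L \<longleftrightarrow> L \<noteq> [] \<and> hd L = x \<and> ear_walk y L \<and> fresh L \<and> set L \<subseteq> K - B \<and>
     (\<forall>i. Suc i < length L \<longrightarrow> L ! Suc i = n (m (L ! i)))" for L
  have "x \<in> V" using x K by blast
  then have good1: "good [x]"
    unfolding good_def fresh_def using x xy mV(4) by auto
  have bound: "length L < Suc (card V)" if "good L" for L
  proof -
    have "card (set L) \<le> card V" using that finV unfolding good_def fresh_def by (intro card_mono) auto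
    then show ?thesis using that distinct_card[of L] unfolding good_def fresh_def by simp
  qed
  obtain L where L: "good L" and mx: "\<And>L'. good L' \<Longrightarrow> length L' \<le> length L"
    using arg_max_nat_lemma[of good "[x]" length "Suc (card V)"] good1 bound by blast
  define w where "w = m (last L)"
  have f: "fresh L" "set L \<subseteq> K - B" "ear_walk y L" "L \<noteq> []" "hd L = x"
    "\<And>i. Suc i < length L \<Longrightarrow> L ! Suc i = n (m (L ! i))" using L unfolding good_def by auto
  have fr: "distinct L" "set L \<subseteq> V" "set L \<inter> m ` set L = {}" using f(1) unfolding fresh_def by auto
  have ll: "last L \<in> set L" "x \<in> set L" using f(4,5) hd_in_set[of L] by auto
  have wv: "w \<in> m ` set L" "w \<notin> set L" using ll fr unfolding w_def by auto
  have wK: "w \<in> K - B" unfolding w_def using mK ll f by blast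
  have wx: "w \<noteq> x" using wv ll by auto
  define z where "z = n w"
  have z: "z \<in> K" "z \<noteq> x" "n z = w" "{w, z} \<in> E" using n[of w] wK wx unfolding z_def by auto
  have we: "walk_end y L = w" unfolding w_def using f(4) by (simp add: walk_end_cases)
  have last: "i = length L - 1" if "i < length L" "m (L ! i) = w" for i
  proof -
    have "L ! i \<in> V" "last L \<in> V" using that ll fr by auto
    then have "L ! i = last L" using that(2) mV(2) unfolding w_def by metis
    then have "L ! i = L ! (length L - 1)" using f(4) by (simp add: last_conv_nth)
    then show ?thesis using fr(1) that(1) by (simp add: nth_eq_iff_index_eq)
  qed
  \<comment> \<open>Both \<open>m\<close> and \<open>n\<close> are involutions, so meeting an
    earlier vertex would make \<open>w\<close> occur earlier on the walk as well; the start
    \<open>x\<close> is not an \<open>n\<close>-partner at all.\<close>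
  have zL: "z \<notin> set L"
  proof
    assume "z \<in> set L"
    then obtain j where j: "j < length L" "L ! j = z" by (metis in_set_conv_nth)
    have "j \<noteq> 0" using j z(2) f(4,5) by (metis hd_conv_nth)
    then obtain i where i: "j = Suc i" by (cases j) auto
    then have zi: "z = n (m (L ! i))" using f(6) j by metis
    have iL: "L ! i \<in> set L" using i j by simp
    then have "m (L ! i) \<in> K" using mK f(2) by blast
    moreover have "m (L ! i) \<noteq> x" using iL fr(3) ll(2) by blast
    ultimately have "m (L ! i) = w" using n zi z(3) by metis
    then show False using last[of i] i j by simp
  qed
  have zmL: "z \<notin> m ` set L"
  proof
    assume "z \<in> m ` set L"
    then obtain i where i: "i < length L" "z = m (L ! i)" by (metis imageE in_set_conv_nth)
    show False
    proof (cases "Suc i < length L")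
      case True
      then have "L ! Suc i = w" using f(6) i z(3) by metis
      then show False using wv(2) True nth_mem by metis
    next
      case False
      then have "i = length L - 1" using i by simp
      then have "z = w" unfolding w_def i(2) using f(4) by (simp add: last_conv_nth)
      then show False using z(4) edgeD by blast
    qed
  qed
  \<comment> \<open>Otherwise \<open>z\<close> could be appended, against the maximal length of
    \<open>L\<close>.\<close>
  have "z \<in> B"
  proof (rule ccontr)
    assume zB: "z \<notin> B"
    have zV: "z \<in> V" using z K by blast
    have "m z \<notin> set L" using zmL mV(2)[OF zV] by (metis imageI)
    moreover have "m z \<noteq> z" using mV[OF zV] by blast
    ultimately have "fresh (L @ [z])" using fr zV zL zmL unfolding fresh_def by auto
    moreover have "(L @ [z]) ! Suc i = n (m ((L @ [z]) ! i))" if i: "Suc i < length (L @ [z])" for i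
    proof (cases "Suc i < length L")
      case True
      then show ?thesis using f(6) by (simp add: nth_append)
    next
      case False
      then have i: "length L = Suc i" using i by simp
      then have "L ! i = last L" using f(4) by (simp add: last_conv_nth)
      then show ?thesis using i unfolding z_def w_def by (simp add: nth_append)
    qed
    ultimately have "good (L @ [z])"
      unfolding good_def using f(2-5) z zB we by (simp add: ear_walk_append)
    then show False using mx[of "L @ [z]"] by simp
  qed
  then show ?thesis using y f z(4) we by blast
qed

text \<open>A maximal subset on which a suitable potential exists is all of \<open>K\<close>, since
  otherwise an odd ear can be added. As \<open>m t\<close> lies outside \<open>K\<close>, no even
  path inside \<open>K\<close> meets the partner of the root, which \<open>meet\<close>
  requires.\<close>

theorem factor_critical_balanced:
  assumes K: "K \<subseteq> V" "t \<in> K" "perfect_matching E (K - {t}) m" "factor_critical E K" and mt: "m t \<notin> K"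
  shows "\<exists>p. \<forall>x\<in>K. \<exists>A\<subseteq>K. even_path p t x A"
proof -
  define blob where "blob B \<longleftrightarrow> B \<subseteq> K \<and> t \<in> B \<and> (\<exists>p. \<forall>x\<in>B. \<exists>A\<subseteq>B. even_path p t x A)" for B
  have b0: "blob {t}" unfolding blob_def using K even_path.base by blast
  have bound: "card B < Suc (card V)" if "blob B" for B
  proof -
    have "B \<subseteq> V" using that K unfolding blob_def by blast
    then show ?thesis using card_mono[OF finV] by (simp add: less_Suc_eq_le)
  qed
  obtain B where B: "blob B" and mx: "\<And>B'. blob B' \<Longrightarrow> card B' \<le> card B"
    using arg_max_nat_lemma[of blob "{t}" card "Suc (card V)"] b0 bound by blast
  obtain p where p: "\<And>x. x \<in> B \<Longrightarrow> \<exists>A\<subseteq>B. even_path p t x A" and BK: "B \<subseteq> K" "t \<in> B"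
    using B unfolding blob_def by blast
  have closed: "m x \<in> B" if x: "x \<in> B" "x \<noteq> t" for x
  proof -
    obtain A where "A \<subseteq> B" "even_path p t x A" using p[OF x(1)] by blast
    then show ?thesis using even_path_closed[of p t x A x] even_path_mem[of p t x A] x by blast
  qed
  show ?thesis
  proof (cases "B = K")
    case True
    then show ?thesis using p by blast
  next
    case False
    then have "B \<subset> K" using BK by blast
    from ex_ear[OF K BK(2) this closed]
    obtain y z L where y: "y \<in> B" and z: "z \<in> B" and L: "L \<noteq> []" "ear_walk y L" "fresh L"
      "set L \<subseteq> K - B" "{walk_end y L, z} \<in> E" by blast
    have LV: "set L \<subseteq> V" using L(3) unfolding fresh_def by blast
    have mL: "m ` set L \<subseteq> K - B"
    proof
      fix v assume "v \<in> m ` set L"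
      then obtain x where x: "x \<in> set L" "v = m x" by blast
      then have "x \<in> K - {t}" "x \<notin> B" using L(4) BK by auto
      then have "m x \<in> K - {t}" "m (m x) = x" using K(3) unfolding perfect_matching_def by simp_all
      then show "v \<in> K - B" using closed[of "m x"] x \<open>x \<notin> B\<close> by auto
    qed
    have vB: "v \<notin> walk_verts L" if "v \<in> B" for v using that mL L(4) by blast
    obtain q where q: "\<forall>v. v \<notin> walk_verts L \<longrightarrow> q v = p v" "consistent_walk q y L"
      using consistent_walk_exists[OF L(2,3) vB[OF y]] by blast
    have ev: "\<exists>A\<subseteq>B. even_path q t x A" if xB: "x \<in> B" for x
    proof -
      obtain A where A: "A \<subseteq> B" "even_path p t x A" using p[OF xB] by blast
      have "p v = q v" if "v \<in> A" for v using q(1)[rule_format, OF vB[OF subsetD[OF A(1) that]]] by simp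
      from even_path_cong[OF A(2) this] A(1) show ?thesis by blast
    qed
    have yV: "y \<in> V" using y BK K by blast
    obtain J where J: "odd_path y z J (walk_verts L)" "sum h J = q y + q (walk_end y L) + h {walk_end y L, z}"
      using consistent_walk_lk[OF q(2) L(3,5) yV vB[OF y] vB[OF z]] L(1) by blast
    obtain X where X: "X \<subseteq> B" "even_path q t z X" using ev z by blast
    obtain Y where Y: "Y \<subseteq> B" "even_path q t y Y" using ev y by blast
    have d: "walk_verts L \<inter> X = {}" "walk_verts L \<inter> Y = {}" using X(1) Y(1) vB by blast+
    have "m t \<notin> X" using mt BK X(1) by blast
    \<comment> \<open>\<open>meet\<close> predicts the total gain of the ear, while all of its edges
      but the last are consistent by construction; so the closing edge is consistent too.\<close>
    from meet[OF X(2) J(1) d(1) Y(2) d(2) this]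
    have cz: "consistent q (walk_end y L) z"
      using J(2) L(5) unfolding consistent_def
      by (cases "q y"; cases "q z"; cases "q (walk_end y L)"; cases "h {walk_end y L, z}") auto
    have r: "consistent_walk q z (rev (map m L))" "consistent q (walk_end z (rev (map m L))) y"
      using consistent_walk_rev[OF q(2) cz LV] by auto
    have mm: "m ` m ` set L = set L" using LV mV(2) by (force simp: image_image)
    have vr: "walk_verts (rev (map m L)) = walk_verts L" using mm by auto
    have "inj_on m (set L)" using LV mV(2) by (metis inj_on_inverseI subset_iff)
    then have fr: "fresh (rev (map m L))"
      using L(3) mL K(1) mm unfolding fresh_def by (auto simp: distinct_map)
    let ?B = "B \<union> walk_verts L"
    have "\<exists>A\<subseteq>?B. even_path q t x A" if x: "x \<in> ?B" for x
    proof -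
      consider "x \<in> B" | "x \<in> set L" | "x \<in> m ` set L" using x by blast
      then show ?thesis
      proof cases
        case 1
        then obtain A where A: "A \<subseteq> B" "even_path q t x A" using ev by blast
        from le_supI1[OF A(1)] A(2) show ?thesis by (intro exI conjI)
      next
        case 2
        have "X \<inter> walk_verts L = {}" using d by blast
        from consistent_walk_evp[OF q(2) L(3) cz X(2) this 2]
        obtain A where A: "A \<subseteq> X \<union> walk_verts L" "even_path q t x A" by blast
        from order_trans[OF A(1) Un_mono[OF X(1) order_refl]] A(2) show ?thesis by (intro exI conjI)
      next
        case 3
        have "Y \<inter> walk_verts (rev (map m L)) = {}" using d(2) unfolding vr by (simp add: Int_commute)
        moreover have "x \<in> set (rev (map m L))" using 3 by simp
        ultimately obtain A where A: "A \<subseteq> Y \<union> walk_verts L" "even_path q t x A"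
          using consistent_walk_evp[OF r(1) fr r(2) Y(2), of x] unfolding vr by blast
        from order_trans[OF A(1) Un_mono[OF Y(1) order_refl]] A(2) show ?thesis by (intro exI conjI)
      qed
    qed
    moreover have "?B \<subseteq> K" "t \<in> ?B" using BK mL L(4) by auto
    ultimately have "blob ?B" unfolding blob_def by (intro conjI exI[of _ q] ballI) simp_all
    then have "card ?B \<le> card B" by (rule mx)
    moreover have "finite ?B" using finite_subset[OF order_trans[OF BK(1) K(1)] finV] by simp
    ultimately have "?B = B" by (metis card_seteq sup_ge1)
    then have "hd L \<in> B" using hd_in_set[OF L(1)] by blast
    then show ?thesis using vB[of "hd L"] hd_in_set[OF L(1)] by blast
  qed
qed

end

section \<open>Contracting the factor-critical parts\<close>

text \<open>The assumption \<open>strong\<close> is strong connectivity of the digraph on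
  \<open>S\<close> with an arc from \<open>s\<close> to \<open>r\<close> whenever \<open>s\<close>
  has a neighbour in \<open>\<sigma> r\<close>: no proper nonempty subset is closed under
  arcs.\<close>

locale barrier_graph = gain_graph +
  fixes S P \<sigma>
  assumes dec: "matched_barrier E V S P \<sigma>" and surj: "\<sigma> ` S = P"
    and mS: "\<And>s. s \<in> S \<Longrightarrow> m s \<in> \<sigma> s"
    and mK: "\<And>s. s \<in> S \<Longrightarrow> perfect_matching E (\<sigma> s - {m s}) m"
    and indep: "\<And>s x. s \<in> S \<Longrightarrow> {s, x} \<in> E \<Longrightarrow> x \<notin> S"
    and strong: "\<And>A. A \<subseteq> S \<Longrightarrow> A \<noteq> {} \<Longrightarrow> (\<And>s x. s \<in> A \<Longrightarrow> {s, x} \<in> E \<Longrightarrow> x \<in> \<Union>(\<sigma> ` A)) \<Longrightarrow> A = S"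
begin

lemma dec':
  shows "S \<union> \<Union>P = V" "S \<inter> \<Union>P = {}" "pairwise (nonadjacent E) P" "\<And>C. C \<in> P \<Longrightarrow> factor_critical E C" "inj_on \<sigma> S"
  using dec unfolding matched_barrier_def by auto

lemma sub: "s \<in> S \<Longrightarrow> \<sigma> s \<subseteq> V" "S \<subseteq> V" "s \<in> S \<Longrightarrow> x \<in> \<sigma> s \<Longrightarrow> x \<notin> S"
  using dec'(1,2) surj by blast+

lemma sigma_nonadjacent: "s \<in> S \<Longrightarrow> r \<in> S \<Longrightarrow> s \<noteq> r \<Longrightarrow> nonadjacent E (\<sigma> s) (\<sigma> r)"
  using pairwiseD[OF dec'(3), of "\<sigma> s" "\<sigma> r"] surj inj_onD[OF dec'(5), of s r] by blast

lemma sigma_disj: "s \<in> S \<Longrightarrow> r \<in> S \<Longrightarrow> x \<in> \<sigma> s \<Longrightarrow> x \<in> \<sigma> r \<Longrightarrow> s = r"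
  using sigma_nonadjacent[of s r] unfolding nonadjacent_def by blast

text \<open>This contracts each \<open>s\<close> together with its part to a single vertex of the
  digraph.\<close>

definition idx :: "'a \<Rightarrow> 'a" where
  "idx x = (if x \<in> S then x else THE s. s \<in> S \<and> x \<in> \<sigma> s)"

lemma idx_S [simp]: "s \<in> S \<Longrightarrow> idx s = s"
  by (simp add: idx_def)

lemma idx_eq: assumes "s \<in> S" "x \<in> \<sigma> s" shows "idx x = s"
proof -
  have "(THE s. s \<in> S \<and> x \<in> \<sigma> s) = s" using assms sigma_disj by (intro the_equality) auto
  then show ?thesis using sub(3)[OF assms] by (simp add: idx_def)
qed

lemma idx_in: assumes "x \<in> V" "x \<notin> S" shows "idx x \<in> S" "x \<in> \<sigma> (idx x)"
proof -
  obtain s where s: "s \<in> S" "x \<in> \<sigma> s" using assms dec'(1) surj by blast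
  then show "idx x \<in> S" "x \<in> \<sigma> (idx x)" using idx_eq[OF s] by simp_all
qed

text \<open>The potential is fixed separately on each \<open>s\<close> with its part. Its mismatch
  on the remaining edges at \<open>S\<close> is repaired later by one constant for each
  part.\<close>

definition local_potential :: "('a \<Rightarrow> bit) \<Rightarrow> bool" where
  "local_potential p \<longleftrightarrow> (\<forall>s\<in>S. consistent p s (m s) \<and> (\<forall>x\<in>\<sigma> s. \<exists>A\<subseteq>\<sigma> s. even_path p (m s) x A))"

lemma ex_local_potential: "\<exists>p. local_potential p"
proof -
  have "\<exists>p. \<forall>x\<in>\<sigma> s. \<exists>A\<subseteq>\<sigma> s. even_path p (m s) x A" if s: "s \<in> S" for s
  proof (rule factor_critical_balanced)
    show "factor_critical E (\<sigma> s)" using dec'(4) surj s by blast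
    have "m (m s) = s" using mV(2) sub(2) s by blast
    then show "m (m s) \<notin> \<sigma> s" using sub(3)[OF s] s by auto
  qed (use s sub mS mK in auto)
  then obtain q where q: "\<And>s x. s \<in> S \<Longrightarrow> x \<in> \<sigma> s \<Longrightarrow> \<exists>A\<subseteq>\<sigma> s. even_path (q s) (m s) x A" by metis
  define p where "p x = (if x \<in> S then q x (m x) + h {x, m x} else q (idx x) x)" for x
  have pq: "p x = q s x" if "s \<in> S" "x \<in> \<sigma> s" for s x
    using that idx_eq sub(3) unfolding p_def by auto
  have "consistent p s (m s)" if s: "s \<in> S" for s
  proof -
    have "p s = q s (m s) + h {s, m s}" using s by (simp add: p_def)
    moreover have "p (m s) = q s (m s)" using pq s mS by blast
    ultimately show ?thesis using mV(3)[of s] s sub(2) unfolding consistent_def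
      by (cases "q s (m s)"; cases "h {s, m s}") auto
  qed
  moreover have "\<exists>A\<subseteq>\<sigma> s. even_path p (m s) x A" if s: "s \<in> S" "x \<in> \<sigma> s" for s x
  proof -
    obtain A where A: "A \<subseteq> \<sigma> s" "even_path (q s) (m s) x A" using q[OF s] by blast
    have "q s v = p v" if "v \<in> A" for v using pq[OF s(1) subsetD[OF A(1) that]] by simp
    from even_path_cong[OF A(2) this] A(1) show ?thesis by blast
  qed
  ultimately show ?thesis unfolding local_potential_def by blast
qed

section \<open>Walks and gains in the contracted digraph\<close>

text \<open>A walk is given by the vertices at which it enters the parts, not by its digraph
  vertices, since several edges may realise the same arc.\<close>

fun arc_walk :: "'a \<Rightarrow> 'a list \<Rightarrow> 'a \<Rightarrow> bool" where
  "arc_walk s [] r \<longleftrightarrow> s = r"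
| "arc_walk s (x # L) r \<longleftrightarrow> {s, x} \<in> E \<and> x \<noteq> m s \<and> arc_walk (idx x) L r"

text \<open>The sum of the defects of \<open>p\<close> along the arcs. The passages inside the parts
  contribute nothing, as \<open>p\<close> is consistent there.\<close>

fun walk_gain :: "('a \<Rightarrow> bit) \<Rightarrow> 'a \<Rightarrow> 'a list \<Rightarrow> bit" where
  "walk_gain p s [] = 0"
| "walk_gain p s (x # L) = h {s, x} + p s + p x + walk_gain p (idx x) L"

lemma arc_walk_append: "arc_walk s (A @ B) r \<longleftrightarrow> (\<exists>q. arc_walk s A q \<and> arc_walk q B r)"
  by (induction A arbitrary: s) auto

lemma walk_gain_append: "arc_walk s A q \<Longrightarrow> walk_gain p s (A @ B) = walk_gain p s A + walk_gain p q B"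
  by (induction A arbitrary: s) (auto simp: add.assoc)

lemma arc_end: assumes "s \<in> S" "{s, x} \<in> E" shows "x \<in> V" "x \<notin> S" "idx x \<in> S" "x \<in> \<sigma> (idx x)"
  using edgeD[OF assms(2)] indep[OF assms] idx_in by blast+

lemma arc_walk_end: "arc_walk s L r \<Longrightarrow> s \<in> S \<Longrightarrow> r \<in> S \<and> (L \<noteq> [] \<longrightarrow> r \<in> idx ` set L)"
proof (induction L arbitrary: s)
  case (Cons x L)
  have "idx x \<in> S" using arc_end(3)[of s x] Cons.prems by simp
  then have "r \<in> S \<and> (L \<noteq> [] \<longrightarrow> r \<in> idx ` set L)" using Cons.IH[of "idx x"] Cons.prems(1) by simp
  then show ?case using Cons.prems by (cases L) auto
qed simp

text \<open>A simple closed walk lifts to an alternating cycle: from the entry vertex of the part of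
  \<open>r\<close> follow the even path to \<open>m r\<close>, cross to \<open>r\<close>, and leave
  by the next arc. The odd path from \<open>s\<close> to \<open>x\<close> is the portion already
  lifted; distinct indices keep the visited parts disjoint.\<close>

lemma simple_closed_aux:
  assumes p: "local_potential p" and s: "s \<in> S"
  shows "odd_path s x J U \<Longrightarrow> x \<in> V - S \<Longrightarrow> arc_walk (idx x) L s \<Longrightarrow> distinct (map idx (x # L)) \<Longrightarrow>
    (\<And>y. y \<in> set (x # L) \<Longrightarrow> U \<inter> insert (idx y) (\<sigma> (idx y)) = {}) \<Longrightarrow>
    sum h J + p x + p s + walk_gain p (idx x) L = 0"
proof (induction L arbitrary: x J U)
  case Nil
  have r: "s = idx x" using Nil.prems by simp
  have x: "x \<in> \<sigma> s" using idx_in Nil.prems r by auto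
  obtain A where A: "A \<subseteq> \<sigma> s" "even_path p (m s) x A" using p s x unfolding local_potential_def by blast
  have "U \<inter> insert s (\<sigma> s) = {}" using Nil.prems(5)[of x] r by simp
  moreover have "s \<notin> \<sigma> s" using sub(3)[OF s] s by auto
  ultimately have "A \<inter> insert s U = {}" using A(1) by auto
  then obtain J' where J': "odd_path s (m s) J' (U \<union> (A - {m s}))" "sum h J' = sum h J + p x + p (m s)"
    using odd_path_extend[OF A(2) Nil.prems(1)] by blast
  have "h {s, m s} = p s + p (m s)" using p s unfolding local_potential_def consistent_def by blast
  with odd_path_alt_sum[OF J'(1)] J'(2) show ?case
    by (cases "p s"; cases "p x"; cases "p (m s)"; cases "sum h J") auto
next
  case (Cons y L)
  define r where "r = idx x"
  have x: "x \<in> \<sigma> r" "r \<in> S" using idx_in Cons.prems(2) r_def by auto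
  have w: "{r, y} \<in> E" "y \<noteq> m r" "arc_walk (idx y) L s" using Cons.prems(3) r_def by auto
  note y = arc_end[OF x(2) w(1)]
  have "s \<in> idx ` set (y # L)" using arc_walk_end[OF Cons.prems(3)] x(2) unfolding r_def by blast
  then have sr: "s \<noteq> r" using Cons.prems(4) r_def by auto
  obtain A where A: "A \<subseteq> \<sigma> r" "even_path p (m r) x A" using p x unfolding local_potential_def by blast
  have Ud: "U \<inter> insert r (\<sigma> r) = {}" using Cons.prems(5)[of x] unfolding r_def by simp
  have sA: "s \<notin> \<sigma> r" using sub(3)[OF x(2)] s by blast
  have "A \<inter> insert s U = {}" using Ud A(1) sA by auto
  then obtain J' where J': "odd_path s (m r) J' (U \<union> (A - {m r}))" "sum h J' = sum h J + p x + p (m r)"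
    using odd_path_extend[OF A(2) Cons.prems(1)] by blast
  have mr: "m r \<in> \<sigma> r" "m (m r) = r" using mS x(2) mV(2) sub(2) by auto
  have iy: "idx y \<noteq> r" using Cons.prems(4) r_def by auto
  have yr: "y \<notin> \<sigma> r" using sigma_disj[OF y(3) x(2) y(4)] iy by blast
  have "y \<notin> U" using Cons.prems(5)[of y] y(4) by auto
  then have yU: "y \<notin> U \<union> (A - {m r})" using yr A(1) by auto
  have st1: "m r \<noteq> s" "s \<noteq> m (m r)" "{m (m r), y} \<in> E" "y \<noteq> m r" using mr sA sr w by auto
  note st = odd_path_step[OF J'(1) st1 yU]
  let ?U = "insert (m r) (insert (m (m r)) (U \<union> (A - {m r})))"
  have "?U \<inter> insert (idx z) (\<sigma> (idx z)) = {}" if z: "z \<in> set (y # L)" for z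
  proof -
    have "r \<notin> idx ` set (y # L)" using Cons.prems(4) r_def by simp
    then have zr: "idx z \<noteq> r" using z by (metis imageI)
    moreover have "idx z \<in> S"
      using z w(3) y(3)
    proof (induction L arbitrary: y)
      case (Cons u L)
      then show ?case using arc_end(3)[of "idx y" u] by auto
    qed auto
    ultimately have "nonadjacent E (\<sigma> r) (\<sigma> (idx z))" "r \<notin> \<sigma> (idx z)" "idx z \<notin> \<sigma> r"
      using sigma_nonadjacent x(2) sub(3) by blast+
    then have "insert r (\<sigma> r) \<inter> insert (idx z) (\<sigma> (idx z)) = {}"
      using zr unfolding nonadjacent_def by auto
    moreover have "U \<inter> insert (idx z) (\<sigma> (idx z)) = {}" using Cons.prems(5)[of z] z by simp
    moreover have "?U \<subseteq> U \<union> insert r (\<sigma> r)" using A(1) mr by auto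
    ultimately show ?thesis by blast
  qed
  then have IH: "sum h (insert {m r, m (m r)} (insert {m (m r), y} J')) + p y + p s + walk_gain p (idx y) L = 0"
    using Cons.prems(4) w(3) y by (intro Cons.IH[OF st(1)]) auto
  have c: "h {m r, m (m r)} = p (m r) + p r"
    using p x(2) mr(2) unfolding local_potential_def consistent_def by (simp add: insert_commute add.commute)
  have "sum h J + p x + p (m r) + (p (m r) + p r) + h {r, y} + p y + p s + walk_gain p (idx y) L = 0"
    using IH unfolding st(2) J'(2) c unfolding mr(2) .
  then show ?case
    unfolding walk_gain.simps r_def[symmetric]
    by (cases "p (m r)"; cases "p r"; cases "p y") (auto simp: ac_simps)
qed

text \<open>A closed walk that repeats an index splits there into two shorter closed walks, and
  gains add up.\<close>

lemma closed_sum: "local_potential p \<Longrightarrow> s \<in> S \<Longrightarrow> arc_walk s L s \<Longrightarrow> walk_gain p s L = 0"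
proof (induction "length L" arbitrary: s L rule: less_induct)
  case less
  show ?case
  proof (cases "distinct (map idx L)")
    case True
    show ?thesis
    proof (cases L)
      case (Cons x L')
      have w: "{s, x} \<in> E" "x \<noteq> m s" "arc_walk (idx x) L' s" using less.prems(3) Cons by auto
      have "sum h {{s, x}} + p x + p s + walk_gain p (idx x) L' = 0"
        using arc_end[OF less.prems(2) w(1)] w True Cons
        by (intro simple_closed_aux[OF less.prems(1,2) odd_path_single[OF w(1,2)]]) auto
      then show ?thesis unfolding Cons by (simp add: ac_simps)
    qed simp
  next
    case False
    then obtain xs ys zs r where *: "map idx L = xs @ r # ys @ r # zs"
      using not_distinct_decomp[of "map idx L"] by auto
    have split: "\<exists>A x D. M = A @ x # D \<and> idx x = r \<and> map idx D = vs"
      if "map idx M = us @ r # vs" for M us vs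
      using map_eq_append_conv[THEN iffD1, OF that] map_eq_Cons_conv by metis
    obtain A x D where L0: "L = A @ x # D" "idx x = r" "map idx D = ys @ r # zs"
      using split[OF *] by blast
    obtain B y C where "D = B @ y # C" "idx y = r" using split[OF L0(3)] by blast
    then have L: "L = A @ x # B @ y # C" "idx x = r" "idx y = r" using L0 by simp_all
    then have L': "L = (A @ [x]) @ (B @ [y]) @ C" by simp
    obtain q q' where q: "arc_walk s (A @ [x]) q" "arc_walk q (B @ [y]) q'" "arc_walk q' C s"
      using less.prems(3) unfolding L' arc_walk_append[of _ "A @ [x]"] arc_walk_append[of _ "B @ [y]"] by blast
    have qr: "q = r" "q' = r" using q L(2,3) by (auto simp: arc_walk_append)
    have rS: "r \<in> S" using arc_walk_end[OF q(1) less.prems(2)] qr by simp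
    have "walk_gain p r (B @ [y]) = 0"
      using q qr by (intro less.hyps[OF _ less.prems(1) rS]) (simp_all add: L(1))
    moreover have sw: "arc_walk s ((A @ [x]) @ C) s"
      using q qr unfolding arc_walk_append[of _ "A @ [x]"] by blast
    have len: "length ((A @ [x]) @ C) < length L" by (simp add: L(1))
    have "walk_gain p s ((A @ [x]) @ C) = 0" by (rule less.hyps[OF len less.prems(1,2) sw])
    moreover have "walk_gain p s L = walk_gain p s (A @ [x]) + (walk_gain p r (B @ [y]) + walk_gain p r C)"
      unfolding L' using walk_gain_append[OF q(1)] walk_gain_append[OF q(2)] qr by metis
    moreover have "walk_gain p s ((A @ [x]) @ C) = walk_gain p s (A @ [x]) + walk_gain p r C"
      using walk_gain_append[OF q(1)] qr by metis
    ultimately show ?thesis by simp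
  qed
qed

text \<open>The set of vertices reachable from \<open>s\<close> is closed under arcs, so
  \<open>strong\<close> applies.\<close>

lemma ex_arc_walk: assumes "s \<in> S" "r \<in> S" shows "\<exists>L. arc_walk s L r"
proof -
  let ?A = "{r \<in> S. \<exists>L. arc_walk s L r}"
  have "arc_walk s [] s" by simp
  then have ne: "?A \<noteq> {}" using assms by blast
  have "?A = S"
  proof (rule strong[OF _ ne])
    fix u x assume u: "u \<in> ?A" "{u, x} \<in> E"
    then have uS: "u \<in> S" by simp
    note x = arc_end[OF uS u(2)]
    have "idx x \<in> ?A"
    proof (cases "x = m u")
      case True
      then show ?thesis using idx_eq[OF uS mS[OF uS]] u by simp
    next
      case False
      obtain L where "arc_walk s L u" using u by blast
      then have "arc_walk s (L @ [x]) (idx x)" using False u(2) by (auto simp: arc_walk_append)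
      then show ?thesis using x by blast
    qed
    then show "x \<in> \<Union>(\<sigma> ` ?A)" using x(4) by blast
  qed blast
  then show ?thesis using assms by blast
qed

text \<open>The correction \<open>q s\<close> is the gain of a walk from a fixed \<open>s0\<close>
  to \<open>s\<close>; adding it to \<open>p\<close> on \<open>s\<close> and its part repairs the
  arcs and leaves the sums inside a part unchanged.\<close>

theorem balanced: "\<exists>p. \<forall>x y. {x, y} \<in> E \<longrightarrow> h {x, y} = p x + p y"
proof (cases "S = {}")
  case True
  then have "V = {}" using dec'(1) surj by simp
  then show ?thesis using edgeD by blast
next
  case False
  then obtain s0 where s0: "s0 \<in> S" by blast
  obtain p where p: "local_potential p" using ex_local_potential by blast
  obtain D where D: "\<And>s. s \<in> S \<Longrightarrow> arc_walk s0 (D s) s" using ex_arc_walk[OF s0] by metis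
  define q where "q s = walk_gain p s0 (D s)" for s
  define f where "f v = p v + q (idx v)" for v
  have SV: "h {s, x} = f s + f x" if s: "s \<in> S" "{s, x} \<in> E" for s x
  proof (cases "x = m s")
    case True
    have "h {s, x} = p s + p x" using p s True unfolding local_potential_def consistent_def by blast
    moreover have "idx x = s" using True idx_eq[OF s(1) mS[OF s(1)]] by simp
    ultimately show ?thesis using s(1) unfolding f_def
      by (cases "p s"; cases "p x"; cases "q s") auto
  next
    case False
    note x = arc_end[OF s]
    \<comment> \<open>The same return walk \<open>L\<close> closes both the walk through the edge
      \<open>{s, x}\<close> and the chosen walk to \<open>idx x\<close>; comparing the two zero
      gains eliminates it.\<close>
    obtain L where L: "arc_walk (idx x) L s0" using ex_arc_walk x s0 by blast
    have "arc_walk s0 (D s @ x # L) s0" using D[OF s(1)] L s(2) False by (auto simp: arc_walk_append)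
    then have "walk_gain p s0 (D s @ x # L) = 0" by (rule closed_sum[OF p s0])
    then have 1: "q s + (h {s, x} + p s + p x + walk_gain p (idx x) L) = 0"
      unfolding walk_gain_append[OF D[OF s(1)]] q_def by simp
    have "arc_walk s0 (D (idx x) @ L) s0" using D x(3) L by (auto simp: arc_walk_append)
    then have "walk_gain p s0 (D (idx x) @ L) = 0" by (rule closed_sum[OF p s0])
    then have 2: "q (idx x) + walk_gain p (idx x) L = 0"
      unfolding walk_gain_append[OF D[OF x(3)]] q_def by simp
    show ?thesis using 1 2 s(1) unfolding f_def
      by (cases "p s"; cases "p x"; cases "q s"; cases "q (idx x)"; cases "h {s, x}"; cases "walk_gain p (idx x) L") auto
  qed
  have "h {x, y} = f x + f y" if e: "{x, y} \<in> E" for x y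
  proof -
    note v = edgeD[OF e]
    consider "x \<in> S" | "y \<in> S" | "x \<notin> S" "y \<notin> S" by blast
    then show ?thesis
    proof cases
      case 1
      then show ?thesis using SV e by blast
    next
      case 2
      then show ?thesis using SV[of y x] e by (simp add: insert_commute add.commute)
    next
      case 3
      note xi = idx_in[OF v(1) 3(1)] and yi = idx_in[OF v(2) 3(2)]
      have i: "idx y = idx x"
      proof (rule ccontr)
        assume "idx y \<noteq> idx x"
        then have "nonadjacent E (\<sigma> (idx x)) (\<sigma> (idx y))" using sigma_nonadjacent xi yi by metis
        then show False using e xi yi unfolding nonadjacent_def by blast
      qed
      have "consistent p x y"
      proof (rule blob_consistent[where B = "\<sigma> (idx x)" and t = "m (idx x)"])
        show "\<exists>A\<subseteq>\<sigma> (idx x). even_path p (m (idx x)) u A" if "u \<in> \<sigma> (idx x)" for u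
          using p xi(1) that unfolding local_potential_def by blast
        have "m (m (idx x)) = idx x" using mV(2) sub(2) xi(1) by blast
        then show "m (m (idx x)) \<notin> \<sigma> (idx x)" using sub(3)[OF xi(1)] xi(1) by auto
      qed (use e xi yi i in auto)
      then show ?thesis using i unfolding consistent_def f_def
        by (cases "p x"; cases "p y"; cases "q (idx x)") auto
    qed
  qed
  then show ?thesis by blast
qed

end

section \<open>Matchings of bridgeless cubic graphs\<close>

definition edge_cut :: "'a set set \<Rightarrow> 'a set \<Rightarrow> 'a set set" where
  "edge_cut E X = {e \<in> E. e \<inter> X \<noteq> {} \<and> \<not> e \<subseteq> X}"

text \<open>The edge count is \<open>3 * card P\<close> \<le> edges leaving the parts \<le> edges at
  \<open>S\<close> \<le> \<open>3 * card S\<close> \<le> \<open>3 * card P\<close>. Equality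
  throughout makes \<open>\<sigma>\<close> onto, every part a 3-edge cut and \<open>S\<close>
  independent. The matching is chosen before \<open>h\<close>, so one matching serves all
  labellings.\<close>

theorem cubic_matching:
  fixes V :: "'a set"
  assumes finV: "finite V" and E2: "\<And>e. e \<in> E \<Longrightarrow> e \<subseteq> V \<and> card e = 2"
    and cubic: "\<And>v. v \<in> V \<Longrightarrow> card (edges_at E v) = 3"
    and conn: "\<And>X. X \<subseteq> V \<Longrightarrow> X \<noteq> {} \<Longrightarrow> X \<noteq> V \<Longrightarrow> \<exists>x\<in>X. \<exists>y\<in>V - X. {x, y} \<in> E"
    and oddcut: "\<And>X. X \<subseteq> V \<Longrightarrow> odd (card X) \<Longrightarrow> 3 \<le> card (edge_cut E X)"
  shows "\<exists>m. perfect_matching E V m \<and> (\<forall>h :: 'a set \<Rightarrow> bit. (\<forall>C. alt_circuit E V m C \<longrightarrow> sum h C = 0) \<longrightarrow>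
           (\<exists>p. \<forall>x y. {x, y} \<in> E \<longrightarrow> h {x, y} = p x + p y))"
proof -
  have "E \<subseteq> Pow V" using E2 by blast
  then have finE: "finite E" using finV by (simp add: finite_subset)
  obtain S P \<sigma> where d: "matched_barrier E V S P \<sigma>" using ex_matched_barrier[OF finV, of E] E2 by blast
  have d': "S \<union> \<Union>P = V" "S \<inter> \<Union>P = {}" "pairwise (nonadjacent E) P" "\<And>C. C \<in> P \<Longrightarrow> odd (card C)"
    "inj_on \<sigma> S" "\<And>s. s \<in> S \<Longrightarrow> \<sigma> s \<in> P" 
    using d unfolding matched_barrier_def by auto
  have finS: "finite S" "finite P"
    using d'(1) finV by (auto intro: finite_subset[of S V] finite_UnionD finite_subset[of "\<Union>P" V])
  have cutD: "\<exists>a s. e = {s, a} \<and> a \<in> C \<and> s \<in> S" if C: "C \<in> P" and e: "e \<in> edge_cut E C" for C e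
  proof -
    obtain a where a: "a \<in> e" "a \<in> C" using e unfolding edge_cut_def by blast
    obtain b where b: "b \<in> e" "b \<notin> C" using e unfolding edge_cut_def by blast
    have eE: "e \<in> E" using e unfolding edge_cut_def by blast
    have ab: "e = {b, a}"
    proof -
      obtain x y where "e = {x, y}" using E2[OF eE] by (meson card_2_iff)
      then show ?thesis using a b by auto
    qed
    have "b \<in> S"
    proof (rule ccontr)
      assume "b \<notin> S"
      moreover have "b \<in> V" using E2[OF eE] b by blast
      ultimately obtain D where D: "D \<in> P" "b \<in> D" using d'(1) by blast
      then have "nonadjacent E D C" using pairwiseD[OF d'(3) D(1) C] b by blast
      then show False using D a eE ab unfolding nonadjacent_def by blast
    qed
    then show ?thesis using ab a by blast
  qed
  have PV: "C \<subseteq> V" "C \<inter> S = {}" if "C \<in> P" for C using d'(1,2) that by blast+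
  have cut_disj: "edge_cut E C \<inter> edge_cut E D = {}" if CD: "C \<in> P" "D \<in> P" "C \<noteq> D" for C D
  proof (rule equals0I)
    fix e assume e: "e \<in> edge_cut E C \<inter> edge_cut E D"
    obtain a s where a: "e = {s, a}" "a \<in> C" "s \<in> S" using cutD[OF CD(1)] e by blast
    obtain a' s' where a': "e = {s', a'}" "a' \<in> D" "s' \<in> S" using cutD[OF CD(2)] e by blast
    have "s \<notin> D" using PV(2)[OF CD(2)] a by blast
    then have "a' = a" using a(1) a'(1,2) by auto
    then show False using a a' pairwiseD[OF d'(3) CD] unfolding nonadjacent_def by blast
  qed
  have fincut: "finite (edge_cut E X)" for X unfolding edge_cut_def using finE by simp
  have fininc: "finite (edges_at E v)" for v unfolding edges_at_def using finE by simp
  have cardcut: "card (\<Union>C\<in>P. edge_cut E C) = (\<Sum>C\<in>P. card (edge_cut E C))"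
    using finS(2) fincut cut_disj by (intro card_UN_disjoint) auto
  have ge3: "3 \<le> card (edge_cut E C)" if "C \<in> P" for C using oddcut PV(1) d'(4) that by blast
  have cutS: "(\<Union>C\<in>P. edge_cut E C) \<subseteq> (\<Union>s\<in>S. edges_at E s)"
  proof
    fix e assume "e \<in> (\<Union>C\<in>P. edge_cut E C)"
    then obtain C where C: "C \<in> P" "e \<in> edge_cut E C" by blast
    then obtain a s where "e = {s, a}" "s \<in> S" using cutD by blast
    then show "e \<in> (\<Union>s\<in>S. edges_at E s)" using C(2) unfolding edges_at_def edge_cut_def by blast
  qed
  have incle: "card (\<Union>s\<in>A. edges_at E s) \<le> 3 * card A" if "A \<subseteq> S" for A
  proof -
    have "card (\<Union>s\<in>A. edges_at E s) \<le> (\<Sum>s\<in>A. card (edges_at E s))"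
      using finite_subset[OF that finS(1)] by (rule card_UN_le)
    also have "\<dots> = (\<Sum>s\<in>A. 3)" using that d'(1) by (intro sum.cong cubic) auto
    finally show ?thesis by simp
  qed
  have "(\<Sum>C\<in>P. 3) \<le> (\<Sum>C\<in>P. card (edge_cut E C))" using ge3 by (intro sum_mono) auto
  then have c1: "3 * card P \<le> card (\<Union>C\<in>P. edge_cut E C)" unfolding cardcut by simp
  have c2: "card (\<Union>C\<in>P. edge_cut E C) \<le> card (\<Union>s\<in>S. edges_at E s)"
    using cutS finS(1) fininc by (intro card_mono) auto
  have c3: "card S \<le> card P"
    using card_inj_on_le[OF d'(5) _ finS(2)] d'(6) by blast
  have c4: "card (\<Union>s\<in>S. edges_at E s) \<le> 3 * card S" by (rule incle) simp
  have SP: "card S = card P" using c1 c2 c3 c4 by linarith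
  have surj: "\<sigma> ` S = P"
    using d'(6) finS SP card_image[OF d'(5)] by (intro card_subset_eq) auto
  have total: "card (\<Union>C\<in>P. edge_cut E C) = 3 * card P" "card (\<Union>s\<in>S. edges_at E s) = 3 * card S"
    using c1 c2 c4 SP by linarith+
  have cut3: "card (edge_cut E C) = 3" if "C \<in> P" for C
  proof (rule ccontr)
    assume "card (edge_cut E C) \<noteq> 3"
    then have "3 < card (edge_cut E C)" using ge3[OF that] by simp
    then have "(\<Sum>C\<in>P. 3) < (\<Sum>C\<in>P. card (edge_cut E C))"
      using ge3 that finS(2) by (intro sum_strict_mono_ex1) auto
    then show False using total(1) cardcut by simp
  qed
  have cutinc: "(\<Union>C\<in>P. edge_cut E C) = (\<Union>s\<in>S. edges_at E s)"
    using cutS finS(1) fininc total SP by (intro card_subset_eq) auto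
  have indep: "x \<notin> S" if "s \<in> S" "{s, x} \<in> E" for s x
  proof -
    have "{s, x} \<in> (\<Union>s\<in>S. edges_at E s)" using that unfolding edges_at_def by blast
    then obtain C where C: "C \<in> P" "{s, x} \<in> edge_cut E C" unfolding cutinc[symmetric] by blast
    then have "s \<notin> C" "{s, x} \<inter> C \<noteq> {}" using PV(2)[OF C(1)] that(1) unfolding edge_cut_def by blast+
    then show ?thesis using PV(2)[OF C(1)] by blast
  qed
  \<comment> \<open>The \<open>3 * card A\<close> edges at \<open>A\<close> exhaust the cuts of the
    parts assigned to \<open>A\<close>. So no edge leaves \<open>A\<close> together with these
    parts, and connectedness makes this all of \<open>V\<close>.\<close>
  have strong: "A = S" if A: "A \<subseteq> S" "A \<noteq> {}" "\<And>s x. s \<in> A \<Longrightarrow> {s, x} \<in> E \<Longrightarrow> x \<in> \<Union>(\<sigma> ` A)" for A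
  proof -
    have finA: "finite A" using A(1) finS(1) finite_subset by blast
    let ?I = "\<Union>s\<in>A. edges_at E s" and ?C = "\<Union>s\<in>A. edge_cut E (\<sigma> s)"
    have "card ?I = (\<Sum>s\<in>A. card (edges_at E s))"
    proof (rule card_UN_disjoint[OF finA], use fininc in blast, intro ballI impI)
      fix s r assume sr: "s \<in> A" "r \<in> A" "s \<noteq> r"
      show "edges_at E s \<inter> edges_at E r = {}"
      proof (rule equals0I)
        fix e assume e: "e \<in> edges_at E s \<inter> edges_at E r"
        then have eE: "e \<in> E" "s \<in> e" "r \<in> e" unfolding edges_at_def by auto
        obtain x y where "e = {x, y}" using E2[OF eE(1)] by (meson card_2_iff)
        then have "e = {s, r}" using eE sr by auto
        then show False using indep[of s r] eE sr A(1) by auto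
      qed
    qed
    also have "\<dots> = (\<Sum>s\<in>A. 3)" using A(1) d'(1) by (intro sum.cong cubic) auto
    finally have cI: "card ?I = 3 * card A" by simp
    have "card ?C \<le> (\<Sum>s\<in>A. card (edge_cut E (\<sigma> s)))" by (rule card_UN_le[OF finA])
    also have "\<dots> = (\<Sum>s\<in>A. 3)" using A(1) d'(6) by (intro sum.cong cut3) auto
    finally have cC: "card ?C \<le> 3 * card A" by simp
    have IC: "?I \<subseteq> ?C"
    proof
      fix e assume "e \<in> ?I"
      then obtain s where s: "s \<in> A" "e \<in> E" "s \<in> e" unfolding edges_at_def by blast
      obtain x where e: "e = {s, x}" using E2[OF s(2)] s(3) by (metis card_2_iff insert_commute insertE singletonD)
      then obtain r where r: "r \<in> A" "x \<in> \<sigma> r" using A(3)[of s x] s by blast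
      have "s \<notin> \<sigma> r" using PV(2)[OF d'(6)] r A(1) s by blast
      then have "e \<in> edge_cut E (\<sigma> r)" unfolding edge_cut_def e using r e s by blast
      then show "e \<in> ?C" using r by blast
    qed
    have finC: "finite ?C" using finA fincut by blast
    have eq: "?I = ?C" using card_mono[OF finC IC] cI cC by (intro card_subset_eq[OF finC IC]) simp
    let ?X = "A \<union> \<Union>(\<sigma> ` A)"
    have XV: "?X \<subseteq> V" using A(1) d'(1,6) by blast
    have "?X = V"
    proof (rule ccontr)
      assume "?X \<noteq> V"
      then obtain x y where xy: "x \<in> ?X" "y \<in> V - ?X" "{x, y} \<in> E" using conn[OF XV] A(2) by blast
      show False
      proof (cases "x \<in> A")
        case True
        then show False using A(3)[OF True xy(3)] xy(2) by blast
      next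
        case False
        then obtain s where s: "s \<in> A" "x \<in> \<sigma> s" using xy(1) by blast
        then have "{x, y} \<in> edge_cut E (\<sigma> s)" using xy unfolding edge_cut_def by blast
        then have "{x, y} \<in> ?I" using eq s(1) by blast
        then obtain r where "r \<in> A" "r \<in> {x, y}" unfolding edges_at_def by blast
        then show False using False xy(2) by blast
      qed
    qed
    moreover have "\<Union>(\<sigma> ` A) \<inter> S = {}" using PV(2) d'(6) A(1) by blast
    ultimately show "A = S" using A(1) d'(1) by blast
  qed
  obtain m where m: "perfect_matching E V m" "\<forall>s\<in>S. m s \<in> \<sigma> s \<and> perfect_matching E (\<sigma> s - {m s}) m"
    using matched_barrier_pmatch[OF d surj] by blast
  have "\<exists>p. \<forall>x y. {x, y} \<in> E \<longrightarrow> h {x, y} = p x + p y"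
    if h: "\<forall>C. alt_circuit E V m C \<longrightarrow> sum h C = 0" for h :: "'a set \<Rightarrow> bit"
  proof -
    have hc: "sum h C = 0" if "alt_circuit E V m C" for C using h that by blast
    have m2: "m s \<in> \<sigma> s" "perfect_matching E (\<sigma> s - {m s}) m" if "s \<in> S" for s using m(2) that by blast+
    interpret barrier_graph V E m h S P \<sigma>
      by unfold_locales (fact finV E2 m(1) hc d surj m2 indep strong)+
    show ?thesis by (rule balanced)
  qed
  then show ?thesis using m(1) by blast
qed

section \<open>Linear algebra over the two-element field\<close>

lemma even_card_sym_diff:
  assumes "finite A" "finite B"
  shows "even (card (sym_diff A B)) \<longleftrightarrow> (even (card A) \<longleftrightarrow> even (card B))"
proof -
  have "card (sym_diff A B) = card (A - B) + card (B - A)"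
    using assms by (intro card_Un_disjoint) auto
  moreover have "card A = card (A - B) + card (A \<inter> B)" "card B = card (B - A) + card (A \<inter> B)"
    using card_Int_Diff[OF assms(1), of B] card_Int_Diff[OF assms(2), of A] by (simp_all add: Int_commute)
  ultimately show ?thesis by simp presburger
qed

text \<open>Rank-nullity by counting: the fibres of \<open>\<phi>\<close> are cosets of its
  kernel.\<close>

lemma card_kernel_image:
  assumes finA: "finite A"
    and hom: "\<And>X Y. X \<subseteq> A \<Longrightarrow> Y \<subseteq> A \<Longrightarrow> \<phi> (sym_diff X Y) = sym_diff (\<phi> X) (\<phi> Y)"
  shows "2 ^ card A = card {X. X \<subseteq> A \<and> \<phi> X = {}} * card (\<phi> ` Pow A)"
proof -
  have fib: "card {X \<in> Pow A. \<phi> X = y} = card {X. X \<subseteq> A \<and> \<phi> X = {}}" if y: "y \<in> \<phi> ` Pow A" for y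
  proof -
    obtain Y where Y: "Y \<subseteq> A" "y = \<phi> Y" using y by blast
    have "bij_betw (\<lambda>X. sym_diff X Y) {X \<in> Pow A. \<phi> X = y} {X. X \<subseteq> A \<and> \<phi> X = {}}"
    proof (rule bij_betw_byWitness[where f' = "\<lambda>X. sym_diff X Y"]; (rule image_subsetI)?)
      fix X assume X: "X \<in> {X \<in> Pow A. \<phi> X = y}"
      then have "\<phi> (sym_diff X Y) = {}" using hom[of X Y] Y by simp
      then show "sym_diff X Y \<in> {X. X \<subseteq> A \<and> \<phi> X = {}}" using X Y(1) by blast
    next
      fix X assume X: "X \<in> {X. X \<subseteq> A \<and> \<phi> X = {}}"
      then have "\<phi> (sym_diff X Y) = y" using hom[of X Y] Y by simp
      then show "sym_diff X Y \<in> {X \<in> Pow A. \<phi> X = y}" using X Y(1) by blast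
    qed auto
    then show ?thesis by (rule bij_betw_same_card)
  qed
  have "card (Pow A) = (\<Sum>y\<in>\<phi> ` Pow A. card {X \<in> Pow A. \<phi> X = y})"
    using sum.image_gen[of "Pow A" "\<lambda>_. 1 :: nat" \<phi>] finA by simp
  also have "\<dots> = (\<Sum>y\<in>\<phi> ` Pow A. card {X. X \<subseteq> A \<and> \<phi> X = {}})" using fib by (rule sum.cong[OF refl])
  finally show ?thesis using finA by (simp add: card_Pow)
qed

text \<open>A maximal subspace that contains \<open>W0\<close> and avoids \<open>H\<close> is a
  hyperplane. The functional is the indicator of its complement, determined by its values on
  singletons.\<close>

lemma ex_separating_functional:
  assumes finE: "finite E" and W0: "W0 \<subseteq> Pow E" "{} \<in> W0"
    "\<And>X Y. X \<in> W0 \<Longrightarrow> Y \<in> W0 \<Longrightarrow> sym_diff X Y \<in> W0"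
    and H: "H \<subseteq> E" "H \<notin> W0"
  shows "\<exists>h :: 'e \<Rightarrow> bit. (\<forall>z\<in>W0. sum h z = 0) \<and> sum h H = 1"
proof -
  define sp where "sp W \<longleftrightarrow> W0 \<subseteq> W \<and> W \<subseteq> Pow E \<and> H \<notin> W \<and> (\<forall>X\<in>W. \<forall>Y\<in>W. sym_diff X Y \<in> W)" for W
  have "sp W0" unfolding sp_def using W0 H by blast
  moreover have "card W < Suc (card (Pow E))" if "sp W" for W
    using that finE card_mono[of "Pow E" W] unfolding sp_def by (simp add: less_Suc_eq_le)
  ultimately obtain W where W: "sp W" and mx: "\<And>W'. sp W' \<Longrightarrow> card W' \<le> card W"
    using arg_max_nat_lemma[of sp W0 card "Suc (card (Pow E))"] by blast
  have w: "W0 \<subseteq> W" "W \<subseteq> Pow E" "H \<notin> W" "\<And>X Y. X \<in> W \<Longrightarrow> Y \<in> W \<Longrightarrow> sym_diff X Y \<in> W"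
    using W unfolding sp_def by auto
  have e0: "{} \<in> W" using w(1) W0(2) by blast
  \<comment> \<open>Adjoining \<open>u\<close> to \<open>W\<close> must produce \<open>H\<close> by
    maximality. Hence everything outside \<open>W\<close> lies in the coset of \<open>H\<close>, and
    \<open>W\<close> has index two.\<close>
  have shift: "sym_diff u H \<in> W" if u: "u \<subseteq> E" "u \<notin> W" for u
  proof (rule ccontr)
    assume no: "sym_diff u H \<notin> W"
    let ?W = "W \<union> (\<lambda>X. sym_diff X u) ` W"
    have uW: "u \<in> ?W" using e0 by (auto intro!: image_eqI[of u _ "{}"])
    have "sp ?W"
      unfolding sp_def
    proof (intro conjI ballI)
      show "W0 \<subseteq> ?W" "?W \<subseteq> Pow E" using w(1,2) u(1) by auto
      show "H \<notin> ?W"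
      proof
        assume "H \<in> ?W"
        then obtain X where X: "X \<in> W" "H = sym_diff X u" using w(3) by blast
        then have "sym_diff u H = X" by auto
        then show False using no X by simp
      qed
      fix X Y assume X: "X \<in> ?W" and Y: "Y \<in> ?W"
      obtain X' where X': "X' \<in> W" "X = X' \<or> X = sym_diff X' u" using X by blast
      obtain Y' where Y': "Y' \<in> W" "Y = Y' \<or> Y = sym_diff Y' u" using Y by blast
      have "sym_diff X Y = sym_diff X' Y' \<or> sym_diff X Y = sym_diff (sym_diff X' Y') u"
        using X'(2) Y'(2) by (elim disjE) auto
      then show "sym_diff X Y \<in> ?W" using w(4)[OF X'(1) Y'(1)] by (elim disjE) simp_all
    qed
    then have "card ?W \<le> card W" by (rule mx)
    moreover have "finite ?W" using finite_subset[OF w(2)] finE by simp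
    ultimately have "?W = W" by (metis card_seteq sup_ge1)
    then show False using uW u(2) by simp
  qed
  have add: "sym_diff u v \<notin> W \<longleftrightarrow> (u \<notin> W) \<noteq> (v \<notin> W)" if uv: "u \<subseteq> E" "v \<subseteq> E" for u v
  proof -
    have 1: "sym_diff (sym_diff u v) u = v" "sym_diff (sym_diff u v) v = u" by auto
    have 2: "sym_diff (sym_diff u H) (sym_diff v H) = sym_diff u v" by auto
    show ?thesis
      using w(4)[of "sym_diff u v" u] w(4)[of "sym_diff u v" v] w(4)[of u v]
        w(4)[OF shift[OF uv(1)] shift[OF uv(2)]] unfolding 1 2 by blast
  qed
  define h :: "'e \<Rightarrow> bit" where "h e = (if {e} \<in> W then 0 else 1)" for e
  have sum: "sum h z = (if z \<in> W then 0 else 1)" if "z \<subseteq> E" for z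
    using finite_subset[OF that finE] that
  proof (induction z rule: finite_induct)
    case empty
    then show ?case using e0 by simp
  next
    case (insert e z)
    have "sym_diff {e} z = insert e z" using insert.hyps by auto
    then show ?case using insert add[of "{e}" z] unfolding h_def by auto
  qed
  have "sum h z = 0" if "z \<in> W0" for z
  proof -
    have "z \<in> W" using that w(1) by blast
    moreover from this have "z \<subseteq> E" using w(2) by blast
    ultimately show ?thesis using sum by simp
  qed
  moreover have "sum h H = 1" using sum[OF H(1)] w(3) by simp
  ultimately show ?thesis by blast
qed

section \<open>The dual graph of a triangulation\<close>

locale projective =
  fixes F :: "'f set" and tri :: "'f \<Rightarrow> 'v set"
  assumes pp: "projective_plane_triangulation F tri"
begin

definition Vt :: "'v set" where "Vt = tri_vertices F tri"
definition Et :: "'v set set" where "Et = tri_edges F tri"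
definition dual_edge :: "'v set \<Rightarrow> 'f set" where "dual_edge e = {f \<in> F. e \<subseteq> tri f}"
definition E :: "'f set set" where "E = dual_edge ` Et"

lemma surf: "finite F" "F \<noteq> {}" "f \<in> F \<Longrightarrow> card (tri f) = 3" "e \<in> Et \<Longrightarrow> card (dual_edge e) = 2"
  "f \<in> F \<Longrightarrow> g \<in> F \<Longrightarrow> (f, g) \<in> (face_adj F tri)\<^sup>*"
  "int (card Vt) - int (card Et) + int (card F) = 1"
  using pp unfolding projective_plane_triangulation_def closed_surface_triangulation_def
    Vt_def Et_def dual_edge_def by auto

lemma Et_iff: "e \<in> Et \<longleftrightarrow> card e = 2 \<and> (\<exists>f\<in>F. e \<subseteq> tri f)"
  unfolding Et_def tri_edges_def by simp

lemma fin_tri: "f \<in> F \<Longrightarrow> finite (tri f)"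
  using surf(3) by (metis card.infinite zero_neq_numeral)

lemma finVE: "finite Vt" "finite Et" "finite E"
proof -
  show V: "finite Vt" unfolding Vt_def tri_vertices_def using surf(1) fin_tri by simp
  have "Et \<subseteq> Pow Vt" using Et_iff unfolding Vt_def tri_vertices_def by blast
  then show "finite Et" using V by (simp add: finite_subset)
  then show "finite E" unfolding E_def by simp
qed

lemma dual_edge_sub: "dual_edge e \<subseteq> F" unfolding dual_edge_def by blast

lemma conn:
  assumes X: "X \<subseteq> F" "X \<noteq> {}" "X \<noteq> F"
  shows "\<exists>x\<in>X. \<exists>y\<in>F - X. \<exists>e\<in>Et. dual_edge e = {x, y}"
proof -
  obtain a b where ab: "a \<in> X" "b \<in> F" "b \<notin> X" using X by blast
  have "(a, b) \<in> (face_adj F tri)\<^sup>*" using surf(5) ab X by blast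
  then have "b \<notin> X \<longrightarrow> (\<exists>x\<in>X. \<exists>y. y \<notin> X \<and> (x, y) \<in> face_adj F tri)"
    by (induction rule: rtrancl_induct) (use ab in blast)+
  then obtain x y where xy: "x \<in> X" "y \<notin> X" "(x, y) \<in> face_adj F tri" using ab by blast
  then obtain e where e: "e \<in> Et" "e \<subseteq> tri x" "e \<subseteq> tri y" "x \<in> F" "y \<in> F" "x \<noteq> y"
    unfolding face_adj_def Et_def by blast
  then have "{x, y} \<subseteq> dual_edge e" unfolding dual_edge_def by blast
  moreover have "finite (dual_edge e)" using dual_edge_sub surf(1) finite_subset by blast
  ultimately have "{x, y} = dual_edge e" using surf(4)[OF e(1)] e(6) by (intro card_subset_eq) auto
  then show ?thesis using xy e by blast
qed

text \<open>Two faces with the same vertex set would close up to a sphere.\<close>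

lemma tri_inj: assumes fg: "f \<in> F" "g \<in> F" "tri f = tri g" shows "f = g"
proof (rule ccontr)
  assume ne: "f \<noteq> g"
  have two: "dual_edge e = {f, g}" if e: "e \<in> Et" "f \<in> dual_edge e \<or> g \<in> dual_edge e" for e
  proof -
    have "{f, g} \<subseteq> dual_edge e" using e(2) fg unfolding dual_edge_def by auto
    moreover have "finite (dual_edge e)" using dual_edge_sub surf(1) finite_subset by blast
    ultimately show ?thesis using surf(4)[OF e(1)] ne by (intro card_subset_eq[symmetric]) auto
  qed
  have F: "F = {f, g}"
  proof (rule ccontr)
    assume "F \<noteq> {f, g}"
    then obtain x y e where "x \<in> {f, g}" "y \<in> F - {f, g}" "e \<in> Et" "dual_edge e = {x, y}"
      using conn[of "{f, g}"] fg by blast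
    then show False using two[of e] by auto
  qed
  have "Vt = \<Union>(tri ` F)" unfolding Vt_def tri_vertices_def ..
  also have "\<dots> = \<Union>(tri ` {f, g})" by (simp only: F[symmetric])
  finally have V: "Vt = tri f" using fg(3) by simp
  have "tri h = tri f" if "h \<in> F" for h using that F fg(3) by blast
  then have "Et = {e. e \<subseteq> tri f \<and> card e = 2}"
    using Et_iff fg(1) by blast
  then have "card Et = 3" using n_subsets[OF fin_tri[OF fg(1)], of 2] surf(3)[OF fg(1)]
    by (simp add: choose_two)
  moreover have "card F = 2" using F ne by (metis card_2_iff)
  \<comment> \<open>The count is 3 - 3 + 2 = 2, not 1.\<close>
  ultimately show False using surf(6) surf(3)[OF fg(1)] V by simp
qed

text \<open>Two different edges shared by the same two faces would span both of them, against
  \<open>tri_inj\<close>. Hence the dual graph is simple and its edges can be represented as pairs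
  of faces.\<close>

lemma dual_edge_inj: "inj_on dual_edge Et"
proof (rule inj_onI)
  fix e e' assume e: "e \<in> Et" "e' \<in> Et" "dual_edge e = dual_edge e'"
  obtain f g where fg: "dual_edge e = {f, g}" "f \<noteq> g" using surf(4)[OF e(1)] by (auto simp: card_2_iff)
  show "e = e'"
  proof (rule ccontr)
    assume ne: "e \<noteq> e'"
    have s: "f \<in> F" "g \<in> F" "e \<subseteq> tri f" "e' \<subseteq> tri f" "e \<subseteq> tri g" "e' \<subseteq> tri g"
      using fg(1) e(3) unfolding dual_edge_def by blast+
    have c: "card e = 2" "card e' = 2" using e Et_iff by auto
    have "e \<union> e' = tri h" if "h \<in> F" "e \<subseteq> tri h" "e' \<subseteq> tri h" for h
    proof (rule card_subset_eq[OF fin_tri[OF that(1)]])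
      show "e \<union> e' \<subseteq> tri h" using that by blast
      have fin: "finite (e \<union> e')" using that fin_tri finite_subset by (metis finite_Un)
      have "e \<noteq> e \<union> e'" using ne c fin card_subset_eq[of e e'] by (metis finite_Un sup.orderI sup_commute le_iff_sup)
      then have "e \<subset> e \<union> e'" by blast
      then have "2 < card (e \<union> e')" using psubset_card_mono[OF fin] c by metis
      moreover have "card (e \<union> e') \<le> 3"
        using card_mono[OF fin_tri[OF that(1)]] that surf(3)[OF that(1)] by (metis Un_least)
      ultimately show "card (e \<union> e') = card (tri h)" using surf(3)[OF that(1)] by simp
    qed
    then have "tri f = tri g" using s by metis
    then show False using tri_inj s fg(2) by blast
  qed
qed

lemma E2: "e \<in> E \<Longrightarrow> e \<subseteq> F \<and> card e = 2"
  unfolding E_def using dual_edge_sub surf(4) by blast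

lemma cardE: "card E = card Et"
  unfolding E_def by (rule card_image[OF dual_edge_inj])

lemma edges_at_image: assumes "D \<subseteq> Et" "f \<in> F"
  shows "edges_at (dual_edge ` D) f = dual_edge ` {e \<in> D. e \<subseteq> tri f}"
  using assms unfolding edges_at_def dual_edge_def by auto

lemma card_edges_at_image: assumes "D \<subseteq> Et" "f \<in> F"
  shows "card (edges_at (dual_edge ` D) f) = card {e \<in> D. e \<subseteq> tri f}"
  unfolding edges_at_image[OF assms] using assms(1) by (intro card_image inj_on_subset[OF dual_edge_inj]) blast

lemma Et_face: "f \<in> F \<Longrightarrow> {e \<in> Et. e \<subseteq> tri f} = {e. e \<subseteq> tri f \<and> card e = 2}"
  using Et_iff by blast

lemma cubic: "f \<in> F \<Longrightarrow> card (edges_at E f) = 3"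
  unfolding E_def using card_edges_at_image[of Et f] Et_face n_subsets[OF fin_tri, of f 2] surf(3)
  by (simp add: choose_two)

lemma pairs3:
  assumes "a \<noteq> b" "b \<noteq> c" "a \<noteq> c"
  shows "{e. e \<subseteq> {a, b, c} \<and> card e = 2} = {{a, b}, {b, c}, {a, c}}"
  using assms by (auto simp: card_2_iff doubleton_eq_iff)

lemma triE: assumes "f \<in> F"
  obtains a b c where "tri f = {a, b, c}" "a \<noteq> b" "b \<noteq> c" "a \<noteq> c"
    "{e \<in> Et. e \<subseteq> tri f} = {{a, b}, {b, c}, {a, c}}"
proof -
  obtain a b c where abc: "tri f = {a, b, c}" "a \<noteq> b" "b \<noteq> c" "a \<noteq> c"
    using surf(3)[OF assms] unfolding card_3_iff by blast
  have "{e \<in> Et. e \<subseteq> tri f} = {{a, b}, {b, c}, {a, c}}"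
    unfolding Et_face[OF assms] unfolding abc(1) by (rule pairs3[OF abc(2-4)])
  then show thesis by (rule that[OF abc])
qed

lemma even_corner: assumes "f \<in> F" shows "even (card {e \<in> {e \<in> Et. u \<in> e}. e \<subseteq> tri f})"
proof -
  obtain a b c where abc: "tri f = {a, b, c}" "a \<noteq> b" "b \<noteq> c" "a \<noteq> c"
    and e: "{e \<in> Et. e \<subseteq> tri f} = {{a, b}, {b, c}, {a, c}}" using triE[OF assms] .
  have "{e \<in> {e \<in> Et. u \<in> e}. e \<subseteq> tri f} = {e \<in> {{a, b}, {b, c}, {a, c}}. u \<in> e}"
    unfolding e[symmetric] by blast
  also have "\<dots> = (if u = a then {{a, b}, {a, c}} else if u = b then {{a, b}, {b, c}}
      else if u = c then {{b, c}, {a, c}} else {})"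
    using abc by auto
  also have "even (card \<dots>)" using abc by (auto simp: doubleton_eq_iff)
  finally show ?thesis .
qed

lemma double_count:
  assumes "Q \<subseteq> Et" "X \<subseteq> F"
  shows "(\<Sum>e\<in>Q. card (dual_edge e \<inter> X)) = (\<Sum>f\<in>X. card {e \<in> Q. e \<subseteq> tri f})"
proof -
  have fin: "finite Q" "finite X" using assms finVE(2) surf(1) finite_subset by blast+
  have "dual_edge e \<inter> X = {f \<in> X. e \<subseteq> tri f}" for e unfolding dual_edge_def using assms(2) by blast
  then show ?thesis using sum_multicount_gen[OF fin, of "\<lambda>e f. e \<subseteq> tri f"] by simp
qed

lemma even_sum_cut:
  assumes "Q \<subseteq> Et" "X \<subseteq> F"
  shows "even (\<Sum>e\<in>Q. card (dual_edge e \<inter> X)) \<longleftrightarrow> even (card {e \<in> Q. card (dual_edge e \<inter> X) = 1})"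
proof -
  have fin: "finite Q" using assms finVE(2) finite_subset by blast
  have "odd (card (dual_edge e \<inter> X)) \<longleftrightarrow> card (dual_edge e \<inter> X) = 1" if "e \<in> Q" for e
  proof -
    have "e \<in> Et" using that assms by blast
    have "card (dual_edge e \<inter> X) \<le> card (dual_edge e)"
      using finite_subset[OF dual_edge_sub surf(1)] by (intro card_mono) auto
    then have "card (dual_edge e \<inter> X) \<le> 2" using surf(4)[OF \<open>e \<in> Et\<close>] by simp
    moreover have "odd k \<longleftrightarrow> k = 1" if "k \<le> 2" for k :: nat using that by presburger
    ultimately show ?thesis by blast
  qed
  then have "{e \<in> Q. odd (card (dual_edge e \<inter> X))} = {e \<in> Q. card (dual_edge e \<inter> X) = 1}" by blast
  then show ?thesis using even_sum_iff[OF fin, of "\<lambda>e. card (dual_edge e \<inter> X)"] by simp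
qed

text \<open>The boundary of a set of faces is an even edge set of the triangulation, so it is never a
  single edge.\<close>

lemma oddcut:
  assumes X: "X \<subseteq> F" "odd (card X)"
  shows "3 \<le> card (edge_cut E X)"
proof -
  define D where "D = {e \<in> Et. card (dual_edge e \<inter> X) = 1}"
  have cut: "edge_cut E X = dual_edge ` D"
  proof -
    have "dual_edge e \<inter> X \<noteq> {} \<and> \<not> dual_edge e \<subseteq> X \<longleftrightarrow> card (dual_edge e \<inter> X) = 1" if e: "e \<in> Et" for e
    proof -
      obtain f g where fg: "dual_edge e = {f, g}" "f \<noteq> g" using surf(4)[OF e] by (auto simp: card_2_iff)
      then show ?thesis by (cases "f \<in> X"; cases "g \<in> X") (auto simp: Int_insert_left)
    qed
    then show ?thesis unfolding edge_cut_def E_def D_def by blast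
  qed
  have DE: "D \<subseteq> Et" unfolding D_def by blast
  have card: "card (edge_cut E X) = card D"
    unfolding cut using inj_on_subset[OF dual_edge_inj DE] by (rule card_image)
  \<comment> \<open>Each face has three edges and only boundary edges count an odd number of times,
    so the size of \<open>D\<close> has the parity of \<open>3 * card X\<close>.\<close>
  have "(\<Sum>e\<in>Et. card (dual_edge e \<inter> X)) = (\<Sum>f\<in>X. card {e \<in> Et. e \<subseteq> tri f})"
    using X by (intro double_count) auto
  also have "\<dots> = (\<Sum>f\<in>X. 3)"
  proof (rule sum.cong[OF refl])
    fix f assume "f \<in> X"
    then have f: "f \<in> F" using X by blast
    show "card {e \<in> Et. e \<subseteq> tri f} = 3"
      using cubic[OF f] card_edges_at_image[of Et f] f unfolding E_def by simp
  qed
  finally have "odd (\<Sum>e\<in>Et. card (dual_edge e \<inter> X))" using X(2) by simp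
  then have odd: "odd (card D)" using even_sum_cut[of Et X] X(1) unfolding D_def by blast
  have "card D \<noteq> 1"
  proof
    assume "card D = 1"
    then obtain e where e: "D = {e}" by (auto simp: card_1_singleton_iff)
    have "card e = 2" using e DE Et_iff by blast
    then obtain u where u: "u \<in> e" by fastforce
    \<comment> \<open>Counting only the edges at an end \<open>u\<close> of the supposed single
      boundary edge: every face has 0 or 2 of them, so an even number of them lies on the
      boundary.\<close>
    let ?Q = "{e \<in> Et. u \<in> e}"
    have "(\<Sum>e\<in>?Q. card (dual_edge e \<inter> X)) = (\<Sum>f\<in>X. card {e \<in> ?Q. e \<subseteq> tri f})"
      using X by (intro double_count) auto
    moreover have "even (\<Sum>f\<in>X. card {e \<in> ?Q. e \<subseteq> tri f})"
      using even_corner X(1) by (intro dvd_sum) blast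
    ultimately have "even (card {e \<in> ?Q. card (dual_edge e \<inter> X) = 1})"
      using even_sum_cut[of ?Q X] X(1) by auto
    moreover have "{e \<in> ?Q. card (dual_edge e \<inter> X) = 1} = {e}" using e u unfolding D_def by blast
    ultimately show False by simp
  qed
  then show ?thesis using odd card by presburger
qed

section \<open>Cuts and even edge sets as mod 2 cochains\<close>

definition coboundary :: "'v set \<Rightarrow> 'f set set" where
  "coboundary A = dual_edge ` {e \<in> Et. e \<inter> A \<noteq> {} \<and> \<not> e \<subseteq> A}"

lemma coboundary_sub: "coboundary A \<subseteq> E" unfolding coboundary_def E_def by blast

lemma card_edges_at_coboundary:
  assumes f: "f \<in> F"
  shows "card (edges_at (coboundary A) f) = (if tri f \<subseteq> A \<or> tri f \<inter> A = {} then 0 else 2)"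
proof -
  obtain a b c where abc: "tri f = {a, b, c}" "a \<noteq> b" "b \<noteq> c" "a \<noteq> c"
    and e: "{e \<in> Et. e \<subseteq> tri f} = {{a, b}, {b, c}, {a, c}}" using triE[OF f] .
  have d: "{a, b} \<noteq> {b, c}" "{b, c} \<noteq> {a, c}" "{a, b} \<noteq> {a, c}" using abc by (auto simp: doubleton_eq_iff)
  have "card (edges_at (coboundary A) f) = card {e \<in> {e \<in> Et. e \<inter> A \<noteq> {} \<and> \<not> e \<subseteq> A}. e \<subseteq> tri f}"
    unfolding coboundary_def by (intro card_edges_at_image[OF _ f]) blast
  also have "{e \<in> {e \<in> Et. e \<inter> A \<noteq> {} \<and> \<not> e \<subseteq> A}. e \<subseteq> tri f} =
      {e \<in> {{a, b}, {b, c}, {a, c}}. e \<inter> A \<noteq> {} \<and> \<not> e \<subseteq> A}"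
    unfolding e[symmetric] by blast
  also have "\<dots> = (if (a \<in> A) \<noteq> (b \<in> A) then {{a, b}} else {}) \<union> (if (b \<in> A) \<noteq> (c \<in> A) then {{b, c}} else {})
      \<union> (if (a \<in> A) \<noteq> (c \<in> A) then {{a, c}} else {})"
    by (cases "a \<in> A"; cases "b \<in> A"; cases "c \<in> A") auto
  also have "card \<dots> = (if tri f \<subseteq> A \<or> tri f \<inter> A = {} then 0 else 2)"
    unfolding abc(1) using d by (cases "a \<in> A"; cases "b \<in> A"; cases "c \<in> A") auto
  finally show ?thesis .
qed

lemma coboundary_hom: "coboundary (sym_diff A B) = sym_diff (coboundary A) (coboundary B)"
proof -
  let ?b = "\<lambda>A. {e \<in> Et. e \<inter> A \<noteq> {} \<and> \<not> e \<subseteq> A}"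
  have "e \<in> ?b (sym_diff A B) \<longleftrightarrow> (e \<in> ?b A) \<noteq> (e \<in> ?b B)" if e: "e \<in> Et" for e
  proof -
    obtain u v where "e = {u, v}" using e Et_iff by (auto simp: card_2_iff)
    then show ?thesis using e
      by (cases "u \<in> A"; cases "v \<in> A"; cases "u \<in> B"; cases "v \<in> B") auto
  qed
  then have "?b (sym_diff A B) = sym_diff (?b A) (?b B)" by auto
  then have "coboundary (sym_diff A B) = dual_edge ` (?b A - ?b B) \<union> dual_edge ` (?b B - ?b A)"
    unfolding coboundary_def by (simp add: image_Un)
  also have "dual_edge ` (?b A - ?b B) = coboundary A - coboundary B" unfolding coboundary_def
    by (rule inj_on_image_set_diff[OF dual_edge_inj]) auto
  also have "dual_edge ` (?b B - ?b A) = coboundary B - coboundary A" unfolding coboundary_def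
    by (rule inj_on_image_set_diff[OF dual_edge_inj]) auto
  finally show ?thesis .
qed

text \<open>If no edge is cut, each face lies inside or outside \<open>A\<close>; faces sharing an
  edge agree, and the surface is connected.\<close>

lemma coboundary_kernel: assumes A: "A \<subseteq> Vt" "coboundary A = {}" shows "A = {} \<or> A = Vt"
proof -
  have face: "tri f \<subseteq> A \<or> tri f \<inter> A = {}" if "f \<in> F" for f
    using card_edges_at_coboundary[OF that, of A] A(2) unfolding edges_at_def by (auto split: if_splits)
  let ?X = "{f \<in> F. tri f \<subseteq> A}"
  have Vt: "Vt = \<Union>(tri ` F)" unfolding Vt_def tri_vertices_def by simp
  consider "?X = {}" | "?X = F" | "?X \<noteq> {}" "?X \<noteq> F" by blast
  then show ?thesis
  proof cases
    case 1
    then have "tri f \<inter> A = {}" if "f \<in> F" for f using face[OF that] that by blast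
    then have "A = {}" using A(1) unfolding Vt by blast
    then show ?thesis by simp
  next
    case 2
    then have "Vt \<subseteq> A" unfolding Vt by blast
    then show ?thesis using A(1) by blast
  next
    case 3
    then obtain x y e where xy: "x \<in> ?X" "y \<in> F - ?X" "e \<in> Et" "dual_edge e = {x, y}"
      using conn[of ?X] by blast
    then have "e \<subseteq> tri x" "e \<subseteq> tri y" unfolding dual_edge_def by blast+
    moreover have "tri y \<inter> A = {}" using face[of y] xy(2) by blast
    ultimately have "e = {}" using xy(1) by blast
    then show ?thesis using xy(3) Et_iff by simp
  qed
qed

text \<open>Cocycles of the triangulation, or equally the cycle space of the dual graph.\<close>

definition cocyc :: "'f set set set" where
  "cocyc = {z. z \<subseteq> E \<and> (\<forall>f\<in>F. even (card (edges_at z f)))}"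

text \<open>The boundary map of the dual graph, with kernel \<open>cocyc\<close>.\<close>

definition bdry :: "'f set set \<Rightarrow> 'f set" where
  "bdry z = {f \<in> F. odd (card (edges_at z f))}"

lemma edges_at_sym_diff: "edges_at (sym_diff X Y) f = sym_diff (edges_at X f) (edges_at Y f)"
  unfolding edges_at_def by auto

lemma fin_edges_at: "X \<subseteq> E \<Longrightarrow> finite (edges_at X f)"
  using finVE(3) unfolding edges_at_def by (auto intro: finite_subset)

lemma even_edges_at_sym_diff: "X \<subseteq> E \<Longrightarrow> Y \<subseteq> E \<Longrightarrow>
  even (card (edges_at (sym_diff X Y) f)) \<longleftrightarrow> (even (card (edges_at X f)) \<longleftrightarrow> even (card (edges_at Y f)))"
  unfolding edges_at_sym_diff by (intro even_card_sym_diff fin_edges_at)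

lemma bdry_hom: "X \<subseteq> E \<Longrightarrow> Y \<subseteq> E \<Longrightarrow> bdry (sym_diff X Y) = sym_diff (bdry X) (bdry Y)"
  unfolding bdry_def using even_edges_at_sym_diff[of X Y] by blast

lemma cocyc_sym_diff: "X \<in> cocyc \<Longrightarrow> Y \<in> cocyc \<Longrightarrow> sym_diff X Y \<in> cocyc"
  unfolding cocyc_def using even_edges_at_sym_diff[of X Y] by blast

lemma coboundary_cocyc: "coboundary A \<in> cocyc"
  unfolding cocyc_def using coboundary_sub card_edges_at_coboundary by auto

text \<open>The image has index at most two: it contains the ends of every dual edge, hence by
  connectedness every pair of a face with \<open>f0\<close>, and these pairs reduce any
  \<open>X\<close> to at most \<open>f0\<close>.\<close>

lemma bdry_image: assumes f0: "f0 \<in> F" and X: "X \<subseteq> F"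
  shows "X \<in> bdry ` Pow E \<or> sym_diff X {f0} \<in> bdry ` Pow E"
proof -
  let ?I = "bdry ` Pow E"
  have cl: "sym_diff A B \<in> ?I" if AB: "A \<in> ?I" "B \<in> ?I" for A B
  proof -
    obtain a b where ab: "a \<subseteq> E" "A = bdry a" "b \<subseteq> E" "B = bdry b" using AB by blast
    then have "sym_diff A B = bdry (sym_diff a b)" using bdry_hom by simp
    moreover have "sym_diff a b \<subseteq> E" using ab by blast
    ultimately show ?thesis by blast
  qed
  have "bdry {} = {}" unfolding bdry_def edges_at_def by simp
  then have e: "{} \<in> ?I" by (metis PowI empty_subsetI image_eqI)
  define R where "R = {f \<in> F. sym_diff {f} {f0} \<in> ?I}"
  have "R = F"
  proof (rule ccontr)
    assume ne: "R \<noteq> F"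
    have "f0 \<in> R" "R \<subseteq> F" unfolding R_def using e f0 by auto
    then obtain x y a where xy: "x \<in> R" "y \<in> F - R" "a \<in> Et" "dual_edge a = {x, y}"
      using conn[of R] ne by blast
    have "{x, y} \<in> E" unfolding E_def using imageI[OF xy(3), of dual_edge] xy(4) by simp
    moreover have "bdry {{x, y}} = {x, y}"
    proof -
      have "edges_at {{x, y}} f = (if f = x \<or> f = y then {{x, y}} else {})" for f unfolding edges_at_def by auto
      then show ?thesis unfolding bdry_def using xy(1,2) \<open>R \<subseteq> F\<close> by auto
    qed
    ultimately have "{x, y} \<in> ?I" by (intro image_eqI[of _ bdry "{{x, y}}"]) auto
    moreover have "sym_diff {x} {f0} \<in> ?I" using xy(1) unfolding R_def by simp
    ultimately have "sym_diff {x, y} (sym_diff {x} {f0}) \<in> ?I" by (rule cl)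
    moreover have "x \<noteq> y" using xy(1,2) by blast
    then have "sym_diff {x, y} (sym_diff {x} {f0}) = sym_diff {y} {f0}" by auto
    ultimately show False using xy(2) unfolding R_def by simp
  qed
  have R: "sym_diff {f} {f0} \<in> ?I" if "f \<in> R" for f using that unfolding R_def by simp
  show ?thesis
    using finite_subset[OF X surf(1)] X
  proof (induction X rule: finite_induct)
    case empty
    then show ?case using e by blast
  next
    case (insert f X)
    then have fR: "sym_diff {f} {f0} \<in> ?I" using R \<open>R = F\<close> by simp
    have insert_eq: "sym_diff (insert f X) {f0} = sym_diff X (sym_diff {f} {f0})" using insert.hyps(2) by auto
    have insert_eq': "insert f X = sym_diff (sym_diff X {f0}) (sym_diff {f} {f0})" using insert.hyps(2) by auto
    have "X \<in> ?I \<or> sym_diff X {f0} \<in> ?I" using insert.prems by (intro insert.IH) simp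
    then consider "X \<in> ?I" | "sym_diff X {f0} \<in> ?I" by (elim disjE)
    then show ?case
    proof cases
      case 1
      from cl[OF this fR] have "sym_diff (insert f X) {f0} \<in> ?I" by (simp only: insert_eq)
      then show ?thesis ..
    next
      case 2
      from cl[OF this fR] have "insert f X \<in> ?I" by (simp only: insert_eq'[symmetric])
      then show ?thesis ..
    qed
  qed
qed

text \<open>The Euler characteristic enters here: cuts have index at most two among the cocycles.\<close>

lemma card_cocyc: "card cocyc \<le> 2 * card (coboundary ` Pow Vt)"
proof -
  obtain f0 where f0: "f0 \<in> F" using surf(2) by blast
  have "{X. X \<subseteq> E \<and> bdry X = {}} = cocyc" unfolding bdry_def cocyc_def by blast
  then have 1: "2 ^ card E = card cocyc * card (bdry ` Pow E)"
    using card_kernel_image[OF finVE(3), of bdry] bdry_hom by simp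
  have finI: "finite (bdry ` Pow E)" using finVE(3) by simp
  have "Pow F \<subseteq> bdry ` Pow E \<union> (\<lambda>X. sym_diff X {f0}) ` (bdry ` Pow E)"
  proof
    fix X assume "X \<in> Pow F"
    then consider "X \<in> bdry ` Pow E" | "sym_diff X {f0} \<in> bdry ` Pow E" using bdry_image[OF f0] by blast
    then show "X \<in> bdry ` Pow E \<union> (\<lambda>X. sym_diff X {f0}) ` (bdry ` Pow E)"
    proof cases
      case 2
      have "X = sym_diff (sym_diff X {f0}) {f0}" by auto
      then show ?thesis using 2 by blast
    qed blast
  qed
  then have "card (Pow F) \<le> card (bdry ` Pow E \<union> (\<lambda>X. sym_diff X {f0}) ` (bdry ` Pow E))"
    using finI by (intro card_mono) auto
  also have "\<dots> \<le> card (bdry ` Pow E) + card (bdry ` Pow E)"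
    using card_Un_le card_image_le[OF finI] by (meson add_left_mono le_trans)
  finally have 2: "2 ^ card F \<le> 2 * card (bdry ` Pow E)" using surf(1) by (simp add: card_Pow)
  have "card {X. X \<subseteq> Vt \<and> coboundary X = {}} \<le> card {{}, Vt}"
    using coboundary_kernel by (intro card_mono) auto
  also have "\<dots> \<le> 2" by (simp add: card_insert_if)
  finally have "card {X. X \<subseteq> Vt \<and> coboundary X = {}} \<le> 2" .
  moreover have "2 ^ card Vt = card {X. X \<subseteq> Vt \<and> coboundary X = {}} * card (coboundary ` Pow Vt)"
    using card_kernel_image[OF finVE(1), of coboundary] coboundary_hom by blast
  ultimately have 3: "2 ^ card Vt \<le> 2 * card (coboundary ` Pow Vt)" by simp
  \<comment> \<open>With both index bounds, 2 to the power \<open>card F\<close> is at most twice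
    the image of \<open>bdry\<close>; cancelling it leaves 2 to the power \<open>card Vt\<close> as
    a bound for \<open>card cocyc\<close>.\<close>
  have "card Vt + card F = card E + 1" using surf(6) cardE by simp
  then have "(2::nat) ^ card Vt * 2 ^ card F = 2 * 2 ^ card E" by (simp flip: power_add)
  also have "\<dots> = card cocyc * (2 * card (bdry ` Pow E))" using 1 by simp
  finally have "card cocyc * 2 ^ card F \<le> 2 ^ card Vt * 2 ^ card F"
    using mult_le_mono2[OF 2, of "card cocyc"] by simp
  then have "card cocyc \<le> 2 ^ card Vt" by simp
  then show ?thesis using 3 by linarith
qed

lemma fin_cocyc: "finite cocyc"
  using finite_subset[of cocyc "Pow E"] finVE(3) unfolding cocyc_def by blast

lemma coboundary_image: "coboundary ` Pow Vt = range coboundary"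
proof -
  have "coboundary A = coboundary (A \<inter> Vt)" for A
  proof -
    have "e \<subseteq> Vt" if "e \<in> Et" for e using that Et_iff unfolding Vt_def tri_vertices_def by blast
    then have "{e \<in> Et. e \<inter> A \<noteq> {} \<and> \<not> e \<subseteq> A} = {e \<in> Et. e \<inter> (A \<inter> Vt) \<noteq> {} \<and> \<not> e \<subseteq> A \<inter> Vt}"
      by blast
    then show ?thesis unfolding coboundary_def by simp
  qed
  then have "coboundary A \<in> coboundary ` Pow Vt" for A by (rule image_eqI) blast
  then show ?thesis by (intro antisym image_mono subset_UNIV image_subsetI)
qed

lemma coboundary_range_sym_diff:
  assumes "X \<in> range coboundary" "Y \<in> range coboundary" shows "sym_diff X Y \<in> range coboundary"
proof -
  obtain A B where "X = coboundary A" "Y = coboundary B" using assms by blast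
  then have "sym_diff X Y = coboundary (sym_diff A B)" by (simp add: coboundary_hom)
  then show ?thesis by (rule range_eqI)
qed

text \<open>Otherwise the cuts and their cosets of \<open>x\<close> and \<open>y\<close> would be
  three disjoint sets of equal size among the cocycles, against \<open>card_cocyc\<close>.\<close>

lemma index_two:
  assumes x: "x \<in> cocyc" "x \<notin> range coboundary" and y: "y \<in> cocyc" "y \<notin> range coboundary"
  shows "sym_diff x y \<in> range coboundary"
proof (rule ccontr)
  assume no: "sym_diff x y \<notin> range coboundary"
  let ?Z = "range coboundary" and ?T = "\<lambda>x. (\<lambda>z. sym_diff z x) ` range coboundary"
  note cl = coboundary_range_sym_diff
  have sub: "?Z \<subseteq> cocyc" using coboundary_cocyc by blast
  then have finZ: "finite ?Z" using fin_cocyc finite_subset by blast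
  have T: "card (?T x) = card ?Z" for x
  proof (rule card_image, rule inj_onI)
    fix a b assume "sym_diff a x = sym_diff b x"
    then have "sym_diff (sym_diff a x) x = sym_diff (sym_diff b x) x" by simp
    moreover have "sym_diff (sym_diff c x) x = c" for c by auto
    ultimately show "a = b" by simp
  qed
  have d1: "?Z \<inter> ?T w = {}" if w: "w \<notin> ?Z" for w
  proof (rule equals0I)
    fix a assume "a \<in> ?Z \<inter> ?T w"
    then obtain b where b: "a \<in> ?Z" "b \<in> ?Z" "a = sym_diff b w" by blast
    have "sym_diff a b = w" unfolding b(3) by auto
    then show False using cl[OF b(1,2)] w by simp
  qed
  have d2: "?T x \<inter> ?T y = {}"
  proof (rule equals0I)
    fix a assume "a \<in> ?T x \<inter> ?T y"
    then obtain b c where b: "b \<in> ?Z" "c \<in> ?Z" "a = sym_diff b x" "a = sym_diff c y" by blast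
    have "sym_diff b c = sym_diff (sym_diff a x) (sym_diff a y)" using b(3,4) by auto
    also have "\<dots> = sym_diff x y" by auto
    finally show False using cl[OF b(1,2)] no by simp
  qed
  have "?Z \<union> ?T x \<union> ?T y \<subseteq> cocyc"
    using sub x(1) y(1) cocyc_sym_diff by blast
  then have "card (?Z \<union> ?T x \<union> ?T y) \<le> card cocyc" using fin_cocyc by (intro card_mono)
  also have "card (?Z \<union> ?T x \<union> ?T y) = card (?Z \<union> ?T x) + card (?T y)"
  proof (rule card_Un_disjoint)
    show "(?Z \<union> ?T x) \<inter> ?T y = {}" by (simp only: Int_Un_distrib2 d1[OF y(2)] d2 Un_empty_left)
  qed (use finZ in simp_all)
  also have "card (?Z \<union> ?T x) = card ?Z + card (?T x)"
    by (rule card_Un_disjoint[OF finZ _ d1[OF x(2)]]) (use finZ in simp)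
  finally have "3 * card ?Z \<le> card cocyc" unfolding T by simp
  moreover have "card cocyc \<le> 2 * card ?Z" using card_cocyc unfolding coboundary_image .
  moreover have "card ?Z > 0" using finZ by (simp add: card_gt_0_iff)
  ultimately show False by linarith
qed

lemma monochromatic_iff:
  assumes "f \<in> F" shows "monochromatic (\<lambda>v. v \<in> A) (tri f) \<longleftrightarrow> edges_at (coboundary A) f = {}"
proof -
  have "monochromatic (\<lambda>v. v \<in> A) (tri f) \<longleftrightarrow> tri f \<subseteq> A \<or> tri f \<inter> A = {}"
    unfolding monochromatic_def by auto
  also have "\<dots> \<longleftrightarrow> card (edges_at (coboundary A) f) = 0" using card_edges_at_coboundary[OF assms, of A] by auto
  also have "\<dots> \<longleftrightarrow> edges_at (coboundary A) f = {}" using fin_edges_at[OF coboundary_sub] by simp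
  finally show ?thesis .
qed

text \<open>After exchanging the sums, each \<open>p v\<close> is counted as often as the degree of
  \<open>v\<close> in \<open>z\<close>, which is even.\<close>

lemma balanced_zero:
  assumes p: "\<forall>x y. {x, y} \<in> E \<longrightarrow> h {x, y} = p x + (p y :: bit)" and z: "z \<in> cocyc"
  shows "sum h z = 0"
proof -
  have zE: "z \<subseteq> E" using z unfolding cocyc_def by blast
  then have fz: "finite z" using finVE(3) finite_subset by blast
  have "h e = (\<Sum>v\<in>F. if v \<in> e then p v else 0)" if "e \<in> z" for e
  proof -
    have e: "e \<in> E" "e \<subseteq> F" "card e = 2" using that zE E2 by blast+
    obtain x y where xy: "e = {x, y}" "x \<noteq> y" using e(3) by (auto simp: card_2_iff)
    have "(\<Sum>v\<in>F. if v \<in> e then p v else 0) = sum p (F \<inter> e)" 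
      using surf(1) by (simp add: sum.inter_restrict)
    also have "F \<inter> e = {x, y}" using e xy by blast
    finally show ?thesis using p e(1) xy by simp
  qed
  then have "sum h z = (\<Sum>e\<in>z. \<Sum>v\<in>F. if v \<in> e then p v else 0)" by (rule sum.cong[OF refl])
  also have "\<dots> = (\<Sum>v\<in>F. \<Sum>e\<in>z. if v \<in> e then p v else 0)" by (rule sum.swap)
  also have "\<dots> = (\<Sum>v\<in>F. 0)"
  proof (rule sum.cong[OF refl])
    fix v assume v: "v \<in> F"
    have "(\<Sum>e\<in>z. if v \<in> e then p v else 0) = (\<Sum>e\<in>edges_at z v. p v)"
      unfolding edges_at_def by (rule sum.inter_filter[OF fz, symmetric])
    also have "\<dots> = of_nat (card (edges_at z v)) * p v" by simp
    also have "even (card (edges_at z v))" using z v unfolding cocyc_def by blast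
    then have "of_nat (card (edges_at z v)) = (0 :: bit)" by (auto elim!: evenE)
    finally show "(\<Sum>e\<in>z. if v \<in> e then p v else 0) = 0" by simp
  qed
  finally show ?thesis by simp
qed

theorem weak_or_near_weak: "\<exists>c. weak_coloring F tri c \<or> near_weak_coloring F tri c"
proof -
  have conn': "\<exists>x\<in>X. \<exists>y\<in>F - X. {x, y} \<in> E" if "X \<subseteq> F" "X \<noteq> {}" "X \<noteq> F" for X
    using conn[OF that] unfolding E_def by (metis imageI)
  obtain m where m: "perfect_matching E F m"
    and bal: "\<And>h :: 'f set \<Rightarrow> bit. (\<forall>C. alt_circuit E F m C \<longrightarrow> sum h C = 0) \<Longrightarrow>
           (\<exists>p. \<forall>x y. {x, y} \<in> E \<longrightarrow> h {x, y} = p x + p y)"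
    using cubic_matching[OF surf(1) E2 cubic conn' oddcut] by blast
  have mf: "m f \<in> F" "m (m f) = f" "{f, m f} \<in> E" if "f \<in> F" for f
    using m that unfolding perfect_matching_def by auto
  define H where "H = E - {{f, m f} | f. f \<in> F}"
  have HE: "H \<subseteq> E" unfolding H_def by blast
  have incH: "edges_at H f = edges_at E f - {{f, m f}}" if f: "f \<in> F" for f
  proof -
    have "{g, m g} = {f, m f}" if "g \<in> F" "f \<in> {g, m g}" for g
      using that mf[OF that(1)] by auto
    then show ?thesis unfolding edges_at_def H_def using f by blast
  qed
  have cardH: "card (edges_at H f) = 2" if f: "f \<in> F" for f
  proof -
    have "{f, m f} \<in> edges_at E f" using mf[OF f] unfolding edges_at_def by simp
    then show ?thesis unfolding incH[OF f] using cubic[OF f] fin_edges_at[of E f] by simp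
  qed
  have Hc: "H \<in> cocyc" unfolding cocyc_def using HE cardH by simp
  show ?thesis
  proof (cases "H \<in> range coboundary")
    case True
    then obtain A where A: "H = coboundary A" by blast
    have "\<not> monochromatic (\<lambda>v. v \<in> A) (tri f)" if "f \<in> F" for f
      using cardH[OF that] monochromatic_iff[OF that] unfolding A by auto
    then show ?thesis unfolding weak_coloring_def by blast
  next
    case False
    have "coboundary {} = {}" unfolding coboundary_def by auto
    then have e: "{} \<in> range coboundary" by (metis rangeI)
    have "range coboundary \<subseteq> Pow E" using coboundary_sub by blast
    then obtain h :: "'f set \<Rightarrow> bit" where h: "\<forall>z\<in>range coboundary. sum h z = 0" "sum h H = 1"
      using ex_separating_functional[OF finVE(3) _ e coboundary_range_sym_diff HE False] by blast
    \<comment> \<open>If \<open>h\<close> vanished on all alternating circuits it would be balanced,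
      and so would vanish on the even set \<open>H\<close>.\<close>
    have "\<not> (\<forall>C. alt_circuit E F m C \<longrightarrow> sum h C = 0)"
    proof
      assume "\<forall>C. alt_circuit E F m C \<longrightarrow> sum h C = 0"
      then obtain p where "\<forall>x y. {x, y} \<in> E \<longrightarrow> h {x, y} = p x + p y" using bal by blast
      then have "sum h H = 0" using Hc by (rule balanced_zero)
      then show False using h(2) by simp
    qed
    then obtain C where C: "alt_circuit E F m C" "sum h C \<noteq> 0" by blast
    then obtain w where CE: "C \<subseteq> E" and
      w: "\<And>f. f \<in> F \<Longrightarrow> edges_at C f = {} \<or> card (edges_at C f) = 2 \<and> ({f, m f} \<in> C \<or> f = w)"
      unfolding alt_circuit_def by blast
    have "even (card (edges_at C f))" if "f \<in> F" for f using w[OF that] by auto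
    then have "C \<in> cocyc" unfolding cocyc_def using CE by blast
    moreover have "C \<notin> range coboundary" using C(2) h(1) by blast
    ultimately have "sym_diff H C \<in> range coboundary" using index_two[OF Hc False] by blast
    then obtain A where A: "sym_diff H C = coboundary A" by blast
    \<comment> \<open>At a monochromatic face, \<open>H\<close> and \<open>C\<close> have the same
      edges. Away from \<open>w\<close> this is impossible, because \<open>C\<close> is nonempty
      there and so contains the matching edge, which \<open>H\<close> omits.\<close>
    have mono: "f = w" if f: "f \<in> F" "monochromatic (\<lambda>v. v \<in> A) (tri f)" for f
    proof (rule ccontr)
      assume fw: "f \<noteq> w"
      have "edges_at (sym_diff H C) f = {}" using monochromatic_iff[OF f(1), of A] f(2) unfolding A by simp
      then have "sym_diff (edges_at H f) (edges_at C f) = {}" unfolding edges_at_sym_diff .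
      then have eq: "edges_at H f = edges_at C f" by blast
      then have "edges_at C f \<noteq> {}" using cardH[OF f(1)] by auto
      then have "{f, m f} \<in> edges_at C f" using w[OF f(1)] fw unfolding edges_at_def by auto
      then show False using eq incH[OF f(1)] by blast
    qed
    let ?M = "{f \<in> F. monochromatic (\<lambda>v. v \<in> A) (tri f)}"
    have "?M = {} \<or> ?M = {w}" using mono by blast
    then show ?thesis
    proof
      assume "?M = {}"
      then have "weak_coloring F tri (\<lambda>v. v \<in> A)" unfolding weak_coloring_def by blast
      then show ?thesis by blast
    next
      assume "?M = {w}"
      then have "near_weak_coloring F tri (\<lambda>v. v \<in> A)" unfolding near_weak_coloring_def by simp
      then show ?thesis by blast
    qed
  qed
qed

end

theorem theorem2p2:
  fixes F :: "'f set" and tri :: "'f \<Rightarrow> 'v set"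
  assumes "projective_plane_triangulation F tri"
  shows "\<exists>c :: 'v \<Rightarrow> bool. weak_coloring F tri c \<or> near_weak_coloring F tri c"
proof -
  interpret projective F tri by unfold_locales (rule assms)
  show ?thesis by (rule weak_or_near_weak)
qed

end
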